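(* Let $\mathbb{F}$ be an algebraically closed field of characteristic different from $2$. Let $b$ be a non-degenerate symmetric bilinear form on a finite-dimensional vector space $V$ over $\mathbb{F}$, and let $u$ be a $b$-selfadjoint endomorphism of $V$. Then there exist $b$-selfadjoint endomorphisms $a_1,a_2$ of $V$ with $a_1^2=a_2^2=0$ and $u=a_1+a_2$ if and only if the following conditions hold: (i) $u$ is similar to $-u$, i.e. $n_{t-\lambda,k}(u)=n_{t+\lambda,k}(u)$ for all $k\ge1$ and all $\lambda\in\mathbb{F}\setminus\{0\}$; (ii) for all $k\ge0$, if $\sum_{i>k}n_{t,2i+1}(u)$ is odd then $n_{t,2k+1}(u)>0$.
   Context: $u$ is $b$-selfadjoint if $b(u(x),y)=b(x,u(y))$ for all $x,y$. For $\lambda\in\mathbb{F}$ and $k\ge1$, $n_{t-\lambda,k}(u)$ denotes the number of Jordan cells of size exactly $k$ of $u$ for the eigenvalue $\lambda$ (so $n_{t,k}(u)$ is for the eigenvalue $0$ and $n_{t+\lambda,k}(u)$ for the eigenvalue $-\lambda$). *)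

theory Defs
  imports
    "HOL-Computational_Algebra.Polynomial"
    "Jordan_Normal_Form.Jordan_Normal_Form"
begin

definition bilinear_form :: "('a::field \<Rightarrow> 'v::ab_group_add \<Rightarrow> 'v) \<Rightarrow> ('v \<Rightarrow> 'v \<Rightarrow> 'a) \<Rightarrow> bool" where
  "bilinear_form scale b \<longleftrightarrow>
     (\<forall>x. Vector_Spaces.linear scale (*) (\<lambda>y. b x y)) \<and>
     (\<forall>y. Vector_Spaces.linear scale (*) (\<lambda>x. b x y))"

definition symmetric_form :: "('v \<Rightarrow> 'v \<Rightarrow> 'a) \<Rightarrow> bool" where
  "symmetric_form b \<longleftrightarrow> (\<forall>x y. b x y = b y x)"

text \<open>One-sided radical; it is only used for symmetric forms, where both radicals coincide.\<close>

definition nondegenerate_form :: "('v::zero \<Rightarrow> 'v \<Rightarrow> 'a::zero) \<Rightarrow> bool" where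
  "nondegenerate_form b \<longleftrightarrow> (\<forall>x. (\<forall>y. b x y = 0) \<longrightarrow> x = 0)"

definition selfadjoint_endo ::
  "('a::field \<Rightarrow> 'v::ab_group_add \<Rightarrow> 'v) \<Rightarrow> ('v \<Rightarrow> 'v \<Rightarrow> 'a) \<Rightarrow> ('v \<Rightarrow> 'v) \<Rightarrow> bool" where
  "selfadjoint_endo scale b u \<longleftrightarrow>
     Vector_Spaces.linear scale scale u \<and> (\<forall>x y. b (u x) y = b x (u y))"

definition similar_endo ::
  "('a::field \<Rightarrow> 'v::ab_group_add \<Rightarrow> 'v) \<Rightarrow> ('v \<Rightarrow> 'v) \<Rightarrow> ('v \<Rightarrow> 'v) \<Rightarrow> bool" where
  "similar_endo scale u v \<longleftrightarrow>
     (\<exists>g. Vector_Spaces.linear scale scale g \<and> bij g \<and> g \<circ> u = v \<circ> g)"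

definition ordered_basis :: "('a::field \<Rightarrow> 'v::ab_group_add \<Rightarrow> 'v) \<Rightarrow> 'v list \<Rightarrow> bool" where
  "ordered_basis scale bs \<longleftrightarrow>
     distinct bs \<and> \<not> module.dependent scale (set bs) \<and> module.span scale (set bs) = UNIV"

text \<open>Column \<open>j\<close> holds the coordinates of \<open>u (bs ! j)\<close> in the ordered basis \<open>bs\<close>.\<close>

definition endo_matrix ::
  "('a::field \<Rightarrow> 'v::ab_group_add \<Rightarrow> 'v) \<Rightarrow> 'v list \<Rightarrow> ('v \<Rightarrow> 'v) \<Rightarrow> 'a mat" where
  "endo_matrix scale bs u =
     mat (length bs) (length bs)
       (\<lambda>(i, j). module.representation scale (set bs) (u (bs ! j)) (bs ! i))"

text \<open>A list entry \<open>(k, ev)\<close> stands for one Jordan cell of size \<open>k\<close> for the eigenvalue \<open>ev\<close>.\<close>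

definition endo_jordan_nf ::
  "('a::field \<Rightarrow> 'v::ab_group_add \<Rightarrow> 'v) \<Rightarrow> ('v \<Rightarrow> 'v) \<Rightarrow> (nat \<times> 'a) list \<Rightarrow> bool" where
  "endo_jordan_nf scale u n_as \<longleftrightarrow>
     (\<exists>bs. ordered_basis scale bs \<and> jordan_nf (endo_matrix scale bs u) n_as)"

text \<open>
  The number of Jordan cells of \<open>u\<close> of size exactly \<open>k\<close> for the eigenvalue \<open>ev\<close>. Over an
  algebraically closed field a Jordan normal form exists, and any two of them agree up to the
  order of the cells, so the result does not depend on the choice made by \<open>SOME\<close>.
\<close>

definition jordan_cells ::
  "('a::field \<Rightarrow> 'v::ab_group_add \<Rightarrow> 'v) \<Rightarrow> ('v \<Rightarrow> 'v) \<Rightarrow> 'a \<Rightarrow> nat \<Rightarrow> nat" where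
  "jordan_cells scale u ev k = count_list (SOME n_as. endo_jordan_nf scale u n_as) (k, ev)"

end

theory Submission
  imports Defs "HOL-Combinatorics.Permutations"
begin

text \<open>
  Put \<open>d = a1 - a2\<close>. For selfadjoint \<open>a1\<close> and \<open>a2\<close> of square zero with \<open>u = a1 + a2\<close> one computes
  \<open>u d = - d u\<close> and \<open>d d = - u u\<close>; conversely, a selfadjoint \<open>d\<close> with these two properties gives
  back \<open>a1 = (u + d) / 2\<close> and \<open>a2 = (u - d) / 2\<close>. So the question is when such a \<open>d\<close> exists.

  Normal form. The space has a Jordan basis for \<open>u\<close> in which different cells are orthogonal and
  \<open>b\<close> pairs the \<open>i\<close>-th vector of a cell of size \<open>m\<close> with the \<open>(m + 1 - i)\<close>-th one
  (\<open>ex_orthonormal_jordan_basis\<close>). It is found by splitting off one nondegenerate cell after the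
  other. The number of cells of each kind is determined by the dimensions of the kernels of
  \<open>(u - c)^k\<close> and can therefore be counted in this basis (\<open>jordan_cells_eq_count_list\<close>).

  Necessity. For \<open>c \<noteq> 0\<close> the map \<open>d\<close> embeds the kernel of \<open>(u - c)^k\<close> into that of \<open>(u + c)^k\<close>,
  which gives the symmetry of the nonzero eigenvalues. For the parity condition, put \<open>p = u^(2k)\<close>
  and look at the symmetric form \<open>b x (p y)\<close>. If \<open>u\<close> has no cell of size \<open>2k + 1\<close> for the
  eigenvalue \<open>0\<close>, then the subspace \<open>im a1 + {z. a1 (p z) = 0 \<and> a2 (p z) = 0}\<close> is its own
  orthogonal complement for this form, so \<open>u^(2k)\<close> has even rank (\<open>even_dim_plus_dim_kernel\<close>).
  The ranks of \<open>u^(2k)\<close> and of a high even power of \<open>u\<close> are then both even, and their difference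
  has the parity of the number of odd cells of size greater than \<open>2k + 1\<close>.

  Sufficiency. The two conditions say exactly that the cells can be matched so that each cell is
  either alone, with eigenvalue \<open>0\<close> and size even or \<open>1\<close>, or paired with a cell of the opposite
  eigenvalue, of the same size or, for two odd cells with eigenvalue \<open>0\<close>, of a size that differs
  by \<open>2\<close> (\<open>ex_cell_pairing\<close>). On such a cell or pair of cells of the normal form, \<open>d\<close> is an
  explicit alternating multiple of a shift (locale \<open>paired_jordan_basis\<close>).
\<close>

section \<open>Endomorphisms and polynomials in them\<close>

context finite_dimensional_vector_space
begin

abbreviation endo :: "('b \<Rightarrow> 'b) \<Rightarrow> bool"
  where "endo f \<equiv> Vector_Spaces.linear scale scale f"

lemma endoI:
  assumes "\<And>x y. f (x + y) = f x + f y" "\<And>c x. f (c *s x) = c *s f x"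
  shows "endo f"
  using assms by (simp add: Vector_Spaces.linear_iff vector_space_axioms)

lemma endo_add: "endo f \<Longrightarrow> f (x + y) = f x + f y"
  and endo_scale: "endo f \<Longrightarrow> f (c *s x) = c *s f x"
  by (simp_all add: Vector_Spaces.linear_iff)

lemma endo_0: "endo f \<Longrightarrow> f 0 = 0"
  using endo_scale[of f 0 0] by simp

lemma endo_neg: "endo f \<Longrightarrow> f (- x) = - f x"
  using endo_scale[of f "-1" x] by simp

lemma endo_diff: "endo f \<Longrightarrow> f (x - y) = f x - f y"
  using endo_add[of f x "-y"] by (simp add: endo_neg)

lemma endo_sum: "endo f \<Longrightarrow> f (sum g A) = (\<Sum>x\<in>A. f (g x))"
  by (induction A rule: infinite_finite_induct) (auto simp: endo_add endo_0)

lemmas endo_simps = endo_add endo_scale endo_0 endo_neg endo_diff endo_sum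

lemma endo_funpow: "endo f \<Longrightarrow> endo (f ^^ n)"
  by (induction n) (auto intro!: endoI simp: endo_simps)

definition poly_endo :: "('b \<Rightarrow> 'b) \<Rightarrow> 'a poly \<Rightarrow> 'b \<Rightarrow> 'b"
  where "poly_endo f p x = (\<Sum>i\<le>degree p. coeff p i *s (f ^^ i) x)"

lemma poly_endo_bound:
  assumes "degree p \<le> n"
  shows "poly_endo f p x = (\<Sum>i\<le>n. coeff p i *s (f ^^ i) x)"
  unfolding poly_endo_def using assms
  by (intro sum.mono_neutral_left) (auto simp: coeff_eq_0)

lemma poly_endo_0 [simp]: "poly_endo f 0 x = 0"
  by (simp add: poly_endo_def)

lemma poly_endo_add: "poly_endo f (p + q) x = poly_endo f p x + poly_endo f q x"
proof -
  let ?n = "max (degree p) (degree q)"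
  have "degree (p + q) \<le> ?n" by (rule degree_add_le) auto
  then show ?thesis
    by (simp add: poly_endo_bound[of _ ?n] sum.distrib scale_left_distrib)
qed

lemma poly_endo_smult: "poly_endo f (Polynomial.smult c p) x = c *s poly_endo f p x"
  by (subst poly_endo_bound[of _ "degree p"])
    (auto simp: poly_endo_def degree_smult_le scale_sum_right)

lemma endo_poly_endo: "endo f \<Longrightarrow> endo (poly_endo f p)"
  by (rule endoI)
    (auto simp: poly_endo_def endo_simps[OF endo_funpow] sum.distrib scale_sum_right
      scale_right_distrib mult.commute)

lemma poly_endo_pCons:
  assumes "endo f"
  shows "poly_endo f (pCons a p) x = a *s x + f (poly_endo f p x)"
proof -
  have "poly_endo f (pCons a p) x = (\<Sum>i\<le>Suc (degree p). coeff (pCons a p) i *s (f ^^ i) x)"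
    by (rule poly_endo_bound) (rule degree_pCons_le)
  also have "\<dots> = a *s x + (\<Sum>i\<le>degree p. coeff p i *s f ((f ^^ i) x))"
    by (subst sum.atMost_Suc_shift) simp
  also have "\<dots> = a *s x + f (poly_endo f p x)"
    by (simp add: poly_endo_def endo_simps[OF assms])
  finally show ?thesis .
qed

lemma poly_endo_mult:
  assumes "endo f"
  shows "poly_endo f (p * q) x = poly_endo f p (poly_endo f q x)"
proof (induction p)
  case (pCons a p)
  then show ?case
    by (simp add: poly_endo_pCons[OF assms] poly_endo_add poly_endo_smult)
qed simp

lemma poly_endo_diff: "poly_endo f (p - q) x = poly_endo f p x - poly_endo f q x"
proof -
  have "p - q = p + Polynomial.smult (-1) q" by simp
  then show ?thesis by (simp only: poly_endo_add poly_endo_smult) simp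
qed

lemma poly_endo_linear_power:
  assumes "endo f"
  shows "poly_endo f ([:- c, 1:] ^ m) x = ((\<lambda>y. f y - c *s y) ^^ m) x"
proof (induction m)
  case 0
  show ?case by (simp add: poly_endo_def)
next
  case (Suc m)
  then show ?case
    unfolding power_Suc poly_endo_mult[OF assms]
    by (simp add: poly_endo_pCons[OF assms] endo_simps[OF assms] algebra_simps)
qed

text \<open>
  Among \<open>x, f x, f (f x), \<dots>\<close> the first \<open>dimension + 1\<close> members either contain a repetition or are
  linearly dependent; both situations give a nonzero polynomial.
\<close>

lemma ex_poly_kills_vector:
  assumes "endo f"
  shows "\<exists>p. p \<noteq> 0 \<and> poly_endo f p x = 0"
proof -
  let ?n = "dimension" let ?g = "\<lambda>i. (f ^^ i) x"
  show ?thesis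
  proof (cases "inj_on ?g {..?n}")
    case False
    then obtain i j where ij: "i \<noteq> j" "?g i = ?g j" by (auto simp: inj_on_def)
    have m: "poly_endo f (monom 1 k) x = ?g k" for k
      by (simp add: poly_endo_def degree_monom_eq if_distrib[of "\<lambda>c. c *s _"] sum.delta cong: if_cong)
    have "monom 1 i \<noteq> (monom 1 j :: 'a poly)"
      using ij by (simp add: monom_eq_iff')
    then show ?thesis
      using ij m by (intro exI[of _ "monom 1 i - monom 1 j"]) (auto simp: poly_endo_diff)
  next
    case True
    then have "card (?g ` {..?n}) = Suc ?n" by (simp add: card_image)
    then have "dependent (?g ` {..?n})"
      using independent_card_le_dim[of "?g ` {..?n}" UNIV] by (auto simp: dim_UNIV dimension_def)
    then obtain c where c: "\<exists>v\<in>?g ` {..?n}. c v \<noteq> 0" "(\<Sum>v\<in>?g ` {..?n}. c v *s v) = 0"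
      by (subst (asm) dependent_finite) auto
    define p where "p = Poly (map (\<lambda>i. c (?g i)) [0..<Suc ?n])"
    have co: "coeff p i = (if i \<le> ?n then c (?g i) else 0)" for i
      by (auto simp: p_def nth_default_def simp del: upt_Suc)
    have "degree p \<le> ?n" by (rule degree_le) (simp add: co)
    then have "poly_endo f p x = (\<Sum>i\<le>?n. c (?g i) *s ?g i)"
      by (simp add: poly_endo_bound co)
    also have "\<dots> = 0" using c(2) True by (simp add: sum.reindex)
    finally have "poly_endo f p x = 0" .
    moreover obtain i where "i \<le> ?n" "c (?g i) \<noteq> 0" using c(1) by auto
    then have "coeff p i \<noteq> 0" by (simp add: co)
    then have "p \<noteq> 0" by auto
    ultimately show ?thesis by blast
  qed
qed

text \<open>
  Polynomials in \<open>f\<close> commute, so the product of polynomials that kill the basis vectors one by one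
  kills all of them.
\<close>

lemma ex_annihilating_poly:
  assumes "endo f"
  shows "\<exists>p. p \<noteq> 0 \<and> (\<forall>x. poly_endo f p x = 0)"
proof -
  have "\<exists>p. p \<noteq> 0 \<and> (\<forall>x\<in>S. poly_endo f p x = 0)" if "finite S" for S
    using that
  proof induction
    case empty
    then show ?case by (intro exI[of _ 1]) auto
  next
    case (insert v S)
    then obtain p where p: "p \<noteq> 0" "\<forall>x\<in>S. poly_endo f p x = 0" by auto
    obtain q where q: "q \<noteq> 0" "poly_endo f q v = 0"
      using ex_poly_kills_vector[OF assms] by blast
    have "poly_endo f (p * q) v = 0"
      by (simp add: poly_endo_mult assms q endo_0[OF endo_poly_endo])
    moreover have "poly_endo f (p * q) x = 0" if "x \<in> S" for x
      using that p by (subst mult.commute) (simp add: poly_endo_mult assms endo_0[OF endo_poly_endo])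
    ultimately show ?case using p q by (intro exI[of _ "p * q"]) auto
  qed
  from this[OF finite_Basis] obtain p where p: "p \<noteq> 0" "\<forall>x\<in>Basis. poly_endo f p x = 0" by blast
  have "poly_endo f p x = 0" for x
  proof -
    have "x \<in> span Basis" by (simp add: span_Basis)
    then show ?thesis
      by (induction rule: span_induct_alt) (auto simp: p endo_simps[OF endo_poly_endo[OF assms]])
  qed
  with p show ?thesis by blast
qed


end

section \<open>Indexed bases and Jordan bases\<close>

definition jordan_index :: "(nat \<times> 'a) list \<Rightarrow> (nat \<times> nat) set"
  where "jordan_index cs = (SIGMA n:{..<length cs}. {1..fst (cs ! n)})"

context finite_dimensional_vector_space
begin

definition indexed_basis :: "'i set \<Rightarrow> ('i \<Rightarrow> 'b) \<Rightarrow> bool"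
  where "indexed_basis I E \<longleftrightarrow> finite I \<and> inj_on E I \<and> independent (E ` I) \<and> span (E ` I) = UNIV"

lemma indexed_basis_induct:
  assumes "indexed_basis I E" "P 0" "\<And>x y. P x \<Longrightarrow> P y \<Longrightarrow> P (x + y)"
    "\<And>a x. P x \<Longrightarrow> P (a *s x)" "\<And>i. i \<in> I \<Longrightarrow> P (E i)"
  shows "P x"
proof -
  have "x \<in> span (E ` I)" using assms(1) by (simp add: indexed_basis_def)
  then show ?thesis by (induction rule: span_induct_alt) (use assms in auto)
qed

lemma indexed_basis_eqI:
  assumes "indexed_basis I E" "endo f" "endo g" "\<And>i. i \<in> I \<Longrightarrow> f (E i) = g (E i)"
  shows "f x = g x"
  by (rule indexed_basis_induct[OF assms(1)])
    (auto simp: endo_simps[OF assms(2)] endo_simps[OF assms(3)] assms(4))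

lemma indexed_basis_extend:
  assumes "indexed_basis I E"
  shows "\<exists>g. endo g \<and> (\<forall>i\<in>I. g (E i) = F i)"
proof -
  interpret pair: vector_space_pair scale scale by unfold_locales
  from assms have ind: "independent (E ` I)" and inj: "inj_on E I" by (auto simp: indexed_basis_def)
  obtain g where "endo g" "\<forall>x\<in>E ` I. g x = F (inv_into I E x)"
    using pair.linear_independent_extend[OF ind, of "\<lambda>x. F (inv_into I E x)"] by blast
  then show ?thesis using inj by (intro exI[of _ g]) auto
qed

definition coordinates :: "'i set \<Rightarrow> ('i \<Rightarrow> 'b) \<Rightarrow> ('i \<Rightarrow> 'b \<Rightarrow> 'a) \<Rightarrow> bool"
  where "coordinates I E X \<longleftrightarrow>
    (\<forall>i\<in>I. \<forall>x y. X i (x + y) = X i x + X i y) \<and> (\<forall>i\<in>I. \<forall>a x. X i (a *s x) = a * X i x) \<and>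
    (\<forall>i\<in>I. \<forall>j\<in>I. X i (E j) = (if i = j then 1 else 0)) \<and> (\<forall>x. x = (\<Sum>i\<in>I. X i x *s E i))"

lemma coordinatesD:
  assumes "coordinates I E X"
  shows "i \<in> I \<Longrightarrow> X i (x + y) = X i x + X i y"
    and "i \<in> I \<Longrightarrow> X i (a *s x) = a * X i x"
    and "i \<in> I \<Longrightarrow> j \<in> I \<Longrightarrow> X i (E j) = (if i = j then 1 else 0)"
    and "x = (\<Sum>i\<in>I. X i x *s E i)"
  using assms by (simp_all only: coordinates_def)

lemma ex_coordinates:
  assumes "indexed_basis I E"
  shows "\<exists>X. coordinates I E X"
proof -
  let ?X = "\<lambda>i x. representation (E ` I) x (E i)"
  from assms have ind: "independent (E ` I)" and sp: "span (E ` I) = UNIV" and inj: "inj_on E I"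
    and fin: "finite I"
    by (auto simp: indexed_basis_def)
  have "x = (\<Sum>i\<in>I. ?X i x *s E i)" for x
    using sum_representation_eq[of "E ` I" x "E ` I"] ind sp inj fin
    by (simp add: sum.reindex)
  moreover have "?X i (E j) = (if i = j then 1 else 0)" if "i \<in> I" "j \<in> I" for i j
    using that inj representation_basis[OF ind, of "E j"] by (auto dest: inj_onD)
  ultimately show ?thesis
    unfolding coordinates_def
    by (intro exI[of _ ?X]) (auto simp: representation_add representation_scale ind sp)
qed

lemma indexed_basis_if_spanning:
  assumes "finite I" "span (E ` I) = UNIV" "card I = dim UNIV"
  shows "indexed_basis I E"
proof -
  have "card (E ` I) \<ge> card I"
    using assms dim_le_card[of UNIV "E ` I"] by simp
  then have "card (E ` I) = card I" using card_image_le[OF assms(1), of E] by simp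
  then show ?thesis
    using assms card_le_dim_spanning[of "E ` I" UNIV] eq_card_imp_inj_on[OF assms(1), of E]
    by (auto simp: indexed_basis_def)
qed

text \<open>
  The \<open>n\<close>-th cell of the list is spanned by \<open>E (n, 1), E (n, 2), \<dots>\<close>, beginning with the
  eigenvector. With \<open>E (n, 0) = 0\<close> the relation for \<open>u (E (n, i))\<close> covers the eigenvector too.
\<close>

definition jordan_basis :: "('b \<Rightarrow> 'b) \<Rightarrow> (nat \<times> 'a) list \<Rightarrow> (nat \<times> nat \<Rightarrow> 'b) \<Rightarrow> bool"
  where "jordan_basis u cs E \<longleftrightarrow> 0 \<notin> fst ` set cs \<and> indexed_basis (jordan_index cs) E \<and>
    (\<forall>n. E (n, 0) = 0) \<and>
    (\<forall>n i. (n, i) \<in> jordan_index cs \<longrightarrow> u (E (n, i)) = snd (cs ! n) *s E (n, i) + E (n, i - 1))"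

end

section \<open>Orthonormal Jordan bases of selfadjoint endomorphisms\<close>

locale selfadjoint_endomorphism = finite_dimensional_vector_space scale Basis
  for scale :: "'a::alg_closed_field \<Rightarrow> 'v::ab_group_add \<Rightarrow> 'v" (infixr "*s" 75)
    and Basis :: "'v set" +
  fixes b :: "'v \<Rightarrow> 'v \<Rightarrow> 'a" and u :: "'v \<Rightarrow> 'v"
  assumes two_nonzero: "(2::'a) \<noteq> 0"
    and bilinear: "bilinear_form scale b"
    and symmetric: "symmetric_form b"
    and nondegenerate: "nondegenerate_form b"
    and selfadjoint: "selfadjoint_endo scale b u"
begin

lemma form_commute: "b x y = b y x"
  using symmetric by (simp add: symmetric_form_def)

lemma form_simps:
  "b (x + y) z = b x z + b y z" "b z (x + y) = b z x + b z y"
  "b (c *s x) z = c * b x z" "b z (c *s x) = c * b z x"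
  using bilinear by (auto simp: bilinear_form_def Vector_Spaces.linear_iff)

lemma form_0: "b 0 z = 0" "b z 0 = 0"
  using form_simps(3)[of 0 0 z] form_simps(4)[of z 0 0] by auto

lemma form_neg: "b (- x) z = - b x z" "b z (- x) = - b z x"
  using form_simps(3)[of "-1" x z] form_simps(4)[of z "-1" x] by auto

lemma form_diff: "b (x - y) z = b x z - b y z" "b z (x - y) = b z x - b z y"
  using form_simps(1)[of x "-y" z] form_simps(2)[of z x "-y"] by (auto simp: form_neg)

lemma form_sum: "b (sum f A) z = (\<Sum>x\<in>A. b (f x) z)" "b z (sum f A) = (\<Sum>x\<in>A. b z (f x))"
  by (induction A rule: infinite_finite_induct) (auto simp: form_simps form_0)

lemmas form_rules = form_simps form_0 form_neg form_diff form_sum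

lemma form_nondegenerate: "(\<And>y. b x y = 0) \<Longrightarrow> x = 0"
  using nondegenerate by (auto simp: nondegenerate_form_def)

lemma endo_u: "endo u"
  and form_u: "b (u x) y = b x (u y)"
  using selfadjoint by (auto simp: selfadjoint_endo_def)

lemmas u_simps = endo_simps[OF endo_u]

abbreviation shifted :: "'a \<Rightarrow> 'v \<Rightarrow> 'v"
  where "shifted c \<equiv> \<lambda>x. u x - c *s x"

lemma endo_shifted: "endo (shifted c)"
  by (rule endoI) (auto simp: u_simps algebra_simps)

lemma form_shifted: "b (shifted c x) y = b x (shifted c y)"
  by (simp add: form_rules form_u)

lemma form_funpow:
  assumes "\<And>x y. b (f x) y = b x (f y)"
  shows "b ((f ^^ n) x) y = b x ((f ^^ n) y)"
proof (induction n arbitrary: x)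
  case (Suc n)
  have "(f ^^ n) (f y) = f ((f ^^ n) y)" by (simp add: funpow_swap1)
  then show ?case using Suc[of "f x"] assms by (simp add: funpow_swap1)
qed simp

lemma form_poly_endo: "b (poly_endo u p x) y = b x (poly_endo u p y)"
  by (simp add: poly_endo_def form_rules form_funpow[of u, OF form_u])

lemma poly_endo_in_subspace:
  assumes "subspace W" "\<And>x. x \<in> W \<Longrightarrow> u x \<in> W" "x \<in> W"
  shows "poly_endo u p x \<in> W"
proof -
  have "(u ^^ i) x \<in> W" for i by (induction i) (use assms in auto)
  then show ?thesis
    unfolding poly_endo_def by (intro subspace_sum subspace_scale assms)
qed

text \<open>
  Polarisation: if \<open>b z (f z)\<close> vanished on \<open>W\<close>, so would \<open>2 * b x (f y)\<close>, which is the value at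
  \<open>x + y\<close> minus the values at \<open>x\<close> and \<open>y\<close>.
\<close>

lemma ex_anisotropic_vector:
  assumes W: "subspace W" and f: "endo f" "\<And>x y. b (f x) y = b x (f y)"
    and xy: "x \<in> W" "y \<in> W" "b x (f y) \<noteq> 0"
  shows "\<exists>z\<in>W. b z (f z) \<noteq> 0"
proof (rule ccontr)
  assume "\<not> ?thesis"
  then have z: "b z (f z) = 0" if "z \<in> W" for z using that by blast
  have "b (x + y) (f (x + y)) = b x (f x) + b y (f y) + 2 * b x (f y)"
    using f(2)[of y x] form_commute[of "f y" x] by (simp add: form_rules endo_simps[OF f(1)])
  then have "2 * b x (f y) = 0"
    using z xy subspace_add[OF W] by simp
  then show False using two_nonzero xy by simp
qed

text \<open>
  Let \<open>f = (t - c)^m * g\<close> with \<open>g\<close> prime to \<open>t - c\<close> be the minimal polynomial of \<open>u\<close> on \<open>W\<close>. It does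
  not divide \<open>(t - c)^(m - 1) * g^2\<close>, so the selfadjoint operator \<open>h\<close> given by the latter is not zero
  on \<open>W\<close>. As \<open>W\<close> is nondegenerate, polarisation yields \<open>z\<close> with \<open>b z (h z) \<noteq> 0\<close>, and \<open>e = g(u) z\<close> is
  killed by \<open>(u - c)^m\<close>. The condition on \<open>e\<close> says that the cell it generates is a nondegenerate
  subspace.
\<close>

lemma ex_cell_generator:
  assumes W: "subspace W" "\<And>x. x \<in> W \<Longrightarrow> u x \<in> W" "W \<noteq> {0}"
    and nd: "\<And>x. x \<in> W \<Longrightarrow> (\<And>y. y \<in> W \<Longrightarrow> b x y = 0) \<Longrightarrow> x = 0"
  shows "\<exists>c m e. m \<ge> 1 \<and> e \<in> W \<and> (shifted c ^^ m) e = 0 \<and> b e ((shifted c ^^ (m - 1)) e) \<noteq> 0"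
proof -
  define I where "I = {p. \<forall>x\<in>W. poly_endo u p x = 0}"
  obtain p0 where "p0 \<noteq> 0" "p0 \<in> I"
    using ex_annihilating_poly[OF endo_u] by (auto simp: I_def)
  then obtain f where f: "f \<noteq> 0" "f \<in> I"
    and fmin: "\<And>p. p \<noteq> 0 \<Longrightarrow> p \<in> I \<Longrightarrow> degree f \<le> degree p"
    using ex_has_least_nat[of "\<lambda>p. p \<noteq> 0 \<and> p \<in> I" p0 degree] by blast
  have dvd: "f dvd p" if "p \<in> I" for p
  proof (rule ccontr)
    assume "\<not> f dvd p"
    then have nz: "p mod f \<noteq> 0" by (simp add: dvd_eq_mod_eq_0)
    have "p mod f = p - (p div f) * f" by (simp add: minus_div_mult_eq_mod)
    then have "p mod f \<in> I"
      using that f by (auto simp: I_def poly_endo_diff poly_endo_mult[OF endo_u]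
        endo_0[OF endo_poly_endo[OF endo_u]])
    then have "degree f \<le> degree (p mod f)" using fmin nz by blast
    then show False using degree_mod_less[of f p] f nz by auto
  qed
  have "degree f > 0"
  proof (rule ccontr)
    assume "\<not> degree f > 0"
    then obtain a where a: "f = [:a:]" by (auto elim: degree_eq_zeroE)
    obtain w where "w \<in> W" "w \<noteq> 0" using W(1,3) subspace_0 by blast
    then show False using f by (auto simp: I_def a poly_endo_def)
  qed
  then obtain c where "poly f c = 0" using alg_closed_imp_poly_has_root by blast
  define m where "m = Polynomial.order c f"
  have m: "m \<ge> 1" using \<open>poly f c = 0\<close> f(1) by (simp add: m_def order_root Suc_le_eq)
  obtain g where g: "f = [:- c, 1:] ^ m * g" "\<not> [:- c, 1:] dvd g"
    using order_decomp[OF f(1), of c] by (auto simp: m_def)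
  define N where "N = shifted c ^^ (m - 1)"
  define h where "h = (\<lambda>x. N (poly_endo u g (poly_endo u g x)))"
  have h: "h x = poly_endo u ([:- c, 1:] ^ (m - 1) * (g * g)) x" for x
    by (simp only: h_def N_def poly_endo_mult[OF endo_u] poly_endo_linear_power[OF endo_u])
  have "[:- c, 1:] ^ (m - 1) * (g * g) \<notin> I"
  proof
    assume "[:- c, 1:] ^ (m - 1) * (g * g) \<in> I"
    then have "[:- c, 1:] ^ m * g dvd [:- c, 1:] ^ (m - 1) * (g * g)"
      using dvd g(1) by simp
    moreover have "[:- c, 1:] ^ m = [:- c, 1:] ^ (m - 1) * [:- c, 1:]"
      by (rule power_minus_mult[symmetric]) (use m in simp)
    then have "[:- c, 1:] ^ m * g = ([:- c, 1:] ^ (m - 1) * g) * [:- c, 1:]"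
      by (simp only: mult_ac)
    moreover have "[:- c, 1:] ^ (m - 1) * (g * g) = ([:- c, 1:] ^ (m - 1) * g) * g"
      by (simp only: mult.assoc)
    ultimately have "([:- c, 1:] ^ (m - 1) * g) * [:- c, 1:] dvd ([:- c, 1:] ^ (m - 1) * g) * g"
      by (simp only:)
    moreover have "[:- c, 1:] ^ (m - 1) * g \<noteq> 0" using f(1) g by auto
    ultimately show False using g(2) by (simp only: dvd_mult_cancel_left) simp
  qed
  then obtain y where y: "y \<in> W" "h y \<noteq> 0" by (auto simp: I_def h)
  have "h y \<in> W" unfolding h by (rule poly_endo_in_subspace[OF W(1,2) y(1)])
  then obtain x where x: "x \<in> W" "b x (h y) \<noteq> 0"
    using nd y(2) form_commute by metis
  have "h = poly_endo u ([:- c, 1:] ^ (m - 1) * (g * g))" by (rule ext) (rule h)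
  then have "endo h" "\<And>x y. b (h x) y = b x (h y)"
    by (auto simp only: endo_poly_endo[OF endo_u] form_poly_endo)
  then obtain z where z: "z \<in> W" "b z (h z) \<noteq> 0"
    using ex_anisotropic_vector[of W h x y] W(1) x y(1) by blast
  define e where "e = poly_endo u g z"
  have com: "N (poly_endo u g x) = poly_endo u g (N x)" for x
    unfolding N_def poly_endo_linear_power[OF endo_u, symmetric] poly_endo_mult[OF endo_u, symmetric]
    by (simp only: mult.commute)
  have "b e (N e) = b z (h z)"
    unfolding e_def form_poly_endo h_def com ..
  moreover have "(shifted c ^^ m) e = poly_endo u f z"
    unfolding g(1) e_def poly_endo_mult[OF endo_u] poly_endo_linear_power[OF endo_u] ..
  moreover have "\<dots> = 0" using f z by (auto simp: I_def)
  moreover have "e \<in> W" unfolding e_def by (rule poly_endo_in_subspace[OF W(1,2) z(1)])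
  ultimately show ?thesis using m z(2) unfolding N_def
    by (intro exI[of _ c] exI[of _ m] exI[of _ e]) auto
qed


text \<open>
  Consider the sequence \<open>k \<mapsto> b e ((u - c)^k e)\<close>, which vanishes from \<open>m\<close> on. Scaling \<open>e\<close> makes its
  entry at \<open>m - 1\<close> equal to \<open>1\<close>. Replacing \<open>e\<close> by \<open>e + a (u - c)^(j + 1) e\<close> changes the entry at
  \<open>m - 2 - j\<close> by \<open>2 a\<close> and leaves the later entries as they are, so the remaining entries can be
  cleared from the top down.
\<close>

lemma ex_normalised_generator:
  assumes W: "subspace W" "\<And>x. x \<in> W \<Longrightarrow> u x \<in> W" and m: "m \<ge> 1"
    and e: "e \<in> W" "(shifted c ^^ m) e = 0" "b e ((shifted c ^^ (m - 1)) e) \<noteq> 0"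
  shows "\<exists>e\<in>W. \<forall>k. (k \<ge> m \<longrightarrow> (shifted c ^^ k) e = 0) \<and>
            b e ((shifted c ^^ k) e) = (if k = m - 1 then 1 else 0)"
proof -
  let ?T = "\<lambda>k. shifted c ^^ k"
  have lin: "endo (?T k)" for k by (rule endo_funpow[OF endo_shifted])
  note T_simps = endo_simps[OF lin]
  have T_add: "?T i (?T j x) = ?T (i + j) x" for i j x by (simp add: funpow_add)
  have T_W: "?T k x \<in> W" if "x \<in> W" for k x
    by (induction k) (use that W subspace_diff subspace_scale in auto)
  have T_adj: "b (?T i x) y = b x (?T i y)" for i x y
    by (rule form_funpow) (rule form_shifted)
  have vanish: "?T k x = 0" if "?T m x = 0" "k \<ge> m" for k x
  proof -
    have "?T k x = ?T (k - m) (?T m x)" using that(2) by (simp add: T_add)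
    then show ?thesis by (simp only: that(1) T_simps)
  qed
  have "\<exists>e\<in>W. ?T m e = 0 \<and> b e (?T (m - 1) e) = 1 \<and>
      (\<forall>i. 1 \<le> i \<and> i \<le> j \<longrightarrow> b e (?T (m - 1 - i) e) = 0)" if "j \<le> m - 1" for j
    using that
  proof (induction j)
    case 0
    obtain s where s: "s ^ 2 = 1 / b e (?T (m - 1) e)"
      using nth_root_exists[of 2] by (auto simp: numeral_2_eq_2)
    show ?case
      using s e subspace_scale[OF W(1)]
      by (intro bexI[of _ "s *s e"]) (auto simp: T_simps form_rules power2_eq_square field_simps)
  next
    case (Suc j)
    then obtain e where e: "e \<in> W" "?T m e = 0" "b e (?T (m - 1) e) = 1"
      "\<And>i. 1 \<le> i \<Longrightarrow> i \<le> j \<Longrightarrow> b e (?T (m - 1 - i) e) = 0" by auto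
    define a where "a = - b e (?T (m - 1 - Suc j) e) / 2"
    define e' where "e' = e + a *s ?T (Suc j) e"
    have exp: "b e' (?T k e') = b e (?T k e) + 2 * a * b e (?T (k + Suc j) e)
        + a * a * b e (?T (k + Suc j + Suc j) e)" for k
      unfolding e'_def
      by (simp del: funpow.simps add: form_rules T_simps T_adj T_add add.commute add.left_commute algebra_simps)
    have hz: "b e (?T k e) = 0" if "k \<ge> m" for k
      using vanish[OF e(2) that] by (simp add: form_0)
    have "e' \<in> W" unfolding e'_def by (intro subspace_add subspace_scale W(1) e(1) T_W)
    moreover have "?T m e' = 0"
      using vanish[OF e(2), of "m + Suc j"] e(2)
      by (simp del: funpow.simps add: e'_def T_simps T_add)
    moreover have "b e' (?T (m - 1) e') = 1"
      using e(3) m by (simp del: funpow.simps add: exp hz)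
    moreover have "b e' (?T (m - 1 - i) e') = 0" if i: "1 \<le> i" "i \<le> Suc j" for i
    proof (cases "i = Suc j")
      case True
      have "m - 1 - Suc j + Suc j = m - 1" using Suc.prems by simp
      then have "b e' (?T (m - 1 - i) e') = b e (?T (m - 1 - Suc j) e) + 2 * a"
        unfolding True exp using e(3) m by (simp only: hz) (simp add: hz)
      then show ?thesis using two_nonzero by (simp add: a_def)
    next
      case False
      then show ?thesis
        using i e(4)[of i] Suc.prems m by (simp del: funpow.simps add: exp hz)
    qed
    ultimately show ?case by blast
  qed
  from this[of "m - 1"] obtain e where e: "e \<in> W" "?T m e = 0" "b e (?T (m - 1) e) = 1"
    "\<And>i. 1 \<le> i \<Longrightarrow> i \<le> m - 1 \<Longrightarrow> b e (?T (m - 1 - i) e) = 0" by auto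
  have "b e (?T k e) = (if k = m - 1 then 1 else 0)" for k
  proof (cases "k \<ge> m")
    case True
    then show ?thesis using vanish[OF e(2)] m by (simp add: form_0)
  next
    case False
    then show ?thesis using e(3) e(4)[of "m - 1 - k"] m by (cases "k = m - 1") auto
  qed
  then show ?thesis using e(1) vanish[OF e(2)] by (intro bexI[of _ e]) auto
qed


text \<open>
  The family that is dual to such a family with respect to \<open>b\<close> is the family itself, with the order
  reversed inside each cell; see \<open>orthonormal_cells_dual\<close>.
\<close>

definition orthonormal_cells :: "(nat \<times> 'a) list \<Rightarrow> (nat \<times> nat \<Rightarrow> 'v) \<Rightarrow> bool"
  where "orthonormal_cells cs E \<longleftrightarrow> 0 \<notin> fst ` set cs \<and> (\<forall>n. E (n, 0) = 0) \<and>
    (\<forall>n i. (n, i) \<in> jordan_index cs \<longrightarrow> u (E (n, i)) = snd (cs ! n) *s E (n, i) + E (n, i - 1)) \<and>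
    (\<forall>n i n' j. (n, i) \<in> jordan_index cs \<longrightarrow> (n', j) \<in> jordan_index cs \<longrightarrow>
        b (E (n, i)) (E (n', j)) = (if n = n' \<and> i + j = Suc (fst (cs ! n)) then 1 else 0))"

text \<open>
  Induction on the dimension: \<open>W\<close> is the orthogonal sum of the cell of a normalised generator, which
  is nondegenerate, and of the orthogonal complement \<open>W'\<close> of this cell in \<open>W\<close>, which inherits the
  hypotheses because the cell is stable under the selfadjoint \<open>u\<close>.
\<close>

lemma ex_orthonormal_cells:
  assumes "subspace W" "\<And>x. x \<in> W \<Longrightarrow> u x \<in> W"
    and "\<And>x. x \<in> W \<Longrightarrow> (\<And>y. y \<in> W \<Longrightarrow> b x y = 0) \<Longrightarrow> x = 0"
  shows "\<exists>cs E. orthonormal_cells cs E \<and> span (E ` jordan_index cs) = W"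
  using assms
proof (induction "dim W" arbitrary: W rule: less_induct)
  case less
  note W = less.prems
  show ?case
  proof (cases "W = {0}")
    case True
    then show ?thesis
      by (intro exI[of _ "[]"] exI[of _ "\<lambda>_. 0"]) (auto simp: orthonormal_cells_def jordan_index_def)
  next
    case False
    obtain c m e0 where m: "m \<ge> 1" and e0: "e0 \<in> W" "(shifted c ^^ m) e0 = 0"
        "b e0 ((shifted c ^^ (m - 1)) e0) \<noteq> 0"
      using ex_cell_generator[OF W(1,2) False W(3)] by blast
    let ?T = "\<lambda>k. shifted c ^^ k"
    obtain e where e: "e \<in> W" "\<And>k. k \<ge> m \<Longrightarrow> ?T k e = 0"
        "\<And>k. b e (?T k e) = (if k = m - 1 then 1 else 0)"
      using ex_normalised_generator[OF W(1,2) m e0] by blast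
    define F where "F i = (if i = 0 then 0 else ?T (m - i) e)" for i
    have T_W: "?T k x \<in> W" if "x \<in> W" for k x
      by (induction k) (use that W subspace_diff subspace_scale in auto)
    have F_W: "F i \<in> W" for i
      using T_W[OF e(1)] subspace_0[OF W(1)] by (simp add: F_def)
    have F_u: "u (F i) = c *s F i + F (i - 1)" if "i \<in> {1..m}" for i
    proof -
      have "shifted c (F i) = ?T (Suc (m - i)) e" using that by (simp add: F_def)
      also have "\<dots> = F (i - 1)"
        using that e(2)[of m] by (cases "i = 1") (auto simp del: funpow.simps simp: F_def Suc_diff_le)
      finally show ?thesis by (simp add: algebra_simps)
    qed
    have F_b: "b (F i) (F j) = (if i + j = Suc m then 1 else 0)" if "i \<in> {1..m}" "j \<in> {1..m}" for i j
    proof -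
      have "b (F i) (F j) = b e (?T (m - i) (?T (m - j) e))"
        using that by (simp add: F_def form_funpow[OF form_shifted])
      also have "\<dots> = b e (?T (m - i + (m - j)) e)" by (simp add: funpow_add)
      finally show ?thesis using that e(3) by auto
    qed
    define W' where "W' = {x \<in> W. \<forall>i\<in>{1..m}. b x (F i) = 0}"
    have W': "subspace W'"
      using W(1) by (auto simp: W'_def subspace_def form_rules)
    have W'_u: "u x \<in> W'" if "x \<in> W'" for x
    proof -
      have "b (u x) (F i) = 0" if i: "i \<in> {1..m}" for i
      proof -
        have "i - 1 = 0 \<or> i - 1 \<in> {1..m}" using i by auto
        then have "b x (F (i - 1)) = 0" "b x (F i) = 0"
          using \<open>x \<in> W'\<close> i by (auto simp: W'_def F_def[of 0] form_0)
        then show ?thesis by (simp only: form_u F_u[OF i] form_rules) simp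
      qed
      then show ?thesis using that W(2) by (auto simp: W'_def)
    qed
    \<comment> \<open>the orthogonal projection onto the new cell\<close>
    define P where "P x = (\<Sum>i\<in>{1..m}. b x (F (Suc m - i)) *s F i)" for x
    have P_b: "b (P x) (F j) = b x (F j)" if j: "j \<in> {1..m}" for x j
    proof -
      have "b (P x) (F j) = (\<Sum>i\<in>{1..m}. if i = Suc m - j then b x (F j) else 0)"
        unfolding P_def form_rules using j by (intro sum.cong) (auto simp: F_b)
      also have "\<dots> = b x (F j)" using j by (subst sum.delta) auto
      finally show ?thesis .
    qed
    have P_span: "P x \<in> span (F ` {1..m})" for x
      unfolding P_def by (intro span_sum span_scale span_base) auto
    have split: "x - P x \<in> W'" if "x \<in> W" for x
    proof -
      have "P x \<in> W" unfolding P_def by (intro subspace_sum subspace_scale W(1) F_W)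
      then show ?thesis using that W(1) P_b by (auto simp: W'_def form_rules subspace_diff)
    qed
    have W'_nd: "x = 0" if x: "x \<in> W'" "\<And>y. y \<in> W' \<Longrightarrow> b x y = 0" for x
    proof (rule W(3))
      show "x \<in> W" using x by (simp add: W'_def)
      fix y assume "y \<in> W"
      then have "b x (y - P y) = 0" by (intro x(2) split)
      moreover have "b x (P y) = 0" using x(1) by (simp add: P_def form_rules W'_def)
      ultimately show "b x y = 0" by (simp add: form_rules)
    qed
    have "F m \<in> W - W'"
      using F_W F_b[of m 1] m by (auto simp: W'_def intro!: bexI[of _ "Suc 0"])
    then have "W' \<subset> W" by (auto simp: W'_def)
    then have "dim W' < dim W"
      using dim_psubset[of W' W] W' W(1) by (simp add: span_eq_iff[THEN iffD2])
    from less.hyps[OF this W' W'_u W'_nd]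
    obtain cs E where cells: "orthonormal_cells cs E" and sp: "span (E ` jordan_index cs) = W'"
      by blast
    have cs: "0 \<notin> fst ` set cs" "\<And>n. E (n, 0) = 0"
      using cells by (auto simp: orthonormal_cells_def)
    have E: "\<And>n i. (n, i) \<in> jordan_index cs \<Longrightarrow> E (n, i) \<in> W'"
        "\<And>n i. (n, i) \<in> jordan_index cs \<Longrightarrow>
          u (E (n, i)) = snd (cs ! n) *s E (n, i) + E (n, i - 1)"
        "\<And>n i n' j. (n, i) \<in> jordan_index cs \<Longrightarrow> (n', j) \<in> jordan_index cs \<Longrightarrow>
          b (E (n, i)) (E (n', j)) = (if n = n' \<and> i + j = Suc (fst (cs ! n)) then 1 else 0)"
      using cells sp by (simp_all only: orthonormal_cells_def) (auto intro: span_base)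
    let ?N = "length cs"
    define cs' where "cs' = cs @ [(m, c)]"
    define E' where "E' = (\<lambda>(n, i). if n = ?N then F i else E (n, i))"
    have idx: "(n, i) \<in> jordan_index cs' \<longleftrightarrow> (n, i) \<in> jordan_index cs \<or> n = ?N \<and> i \<in> {1..m}" for n i
      by (auto simp: jordan_index_def cs'_def nth_append)
    have old: "n \<noteq> ?N \<and> E' (n, i) = E (n, i) \<and> E' (n, i - 1) = E (n, i - 1) \<and> cs' ! n = cs ! n"
      if "(n, i) \<in> jordan_index cs" for n i
      using that by (auto simp: jordan_index_def E'_def cs'_def nth_append)
    have ne: "?N \<noteq> n" if "(n, i) \<in> jordan_index cs" for n i
      using old[OF that] by auto
    have new: "E' (?N, i) = F i" "cs' ! ?N = (m, c)" for i
      by (auto simp: E'_def cs'_def)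
    have orth: "b (E (n, i)) (F j) = 0" "b (F j) (E (n, i)) = 0"
      if "(n, i) \<in> jordan_index cs" "j \<in> {1..m}" for n i j
      using E(1)[OF that(1)] that(2) form_commute[of "F j"] by (auto simp: W'_def)
    have "E' ` jordan_index cs' = E ` jordan_index cs \<union> F ` {1..m}"
    proof -
      have "jordan_index cs' = jordan_index cs \<union> {?N} \<times> {1..m}" by (auto simp: idx)
      moreover have "E' ` jordan_index cs = E ` jordan_index cs"
        by (rule image_cong) (use old in auto)
      moreover have "{?N} \<times> {1..m} = Pair ?N ` {1..m}" by auto
      then have "E' ` ({?N} \<times> {1..m}) = F ` {1..m}" by (simp add: image_image new)
      ultimately show ?thesis by (simp add: image_Un)
    qed
    moreover have "x \<in> span (E ` jordan_index cs \<union> F ` {1..m})" if "x \<in> W" for x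
    proof -
      have "x - P x \<in> span (E ` jordan_index cs \<union> F ` {1..m})"
        using split[OF that] sp span_mono[of "E ` jordan_index cs"] by blast
      moreover have "P x \<in> span (E ` jordan_index cs \<union> F ` {1..m})"
        using P_span span_mono[of "F ` {1..m}"] by blast
      ultimately show ?thesis using span_add by fastforce
    qed
    ultimately have "W \<subseteq> span (E' ` jordan_index cs')" by auto
    moreover have "0 \<notin> fst ` set cs'" using cs(1) m by (auto simp: cs'_def)
    moreover have "E' (n, 0) = 0" for n using cs(2) by (simp add: E'_def F_def)
    moreover have EW: "E' (n, i) \<in> W \<and> u (E' (n, i)) = snd (cs' ! n) *s E' (n, i) + E' (n, i - 1)"
      if "(n, i) \<in> jordan_index cs'" for n i
      using that unfolding idx
    proof
      assume "(n, i) \<in> jordan_index cs"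
      then show ?thesis using old E(1,2) by (simp add: W'_def)
    next
      assume "n = ?N \<and> i \<in> {1..m}"
      then show ?thesis using F_W F_u by (simp add: new)
    qed
    moreover have "b (E' (n, i)) (E' (n', j)) = (if n = n' \<and> i + j = Suc (fst (cs' ! n)) then 1 else 0)"
      if "(n, i) \<in> jordan_index cs'" "(n', j) \<in> jordan_index cs'" for n i n' j
      using that unfolding idx
      by (elim disjE conjE) (simp_all add: old ne E(3) new F_b orth)
    ultimately have "orthonormal_cells cs' E'" "W \<subseteq> span (E' ` jordan_index cs')"
      by (simp_all add: orthonormal_cells_def)
    moreover have "span (E' ` jordan_index cs') \<subseteq> W"
      using EW W(1) by (intro span_minimal) auto
    ultimately show ?thesis by blast
  qed
qed

lemma orthonormal_cells_dual:
  assumes cells: "orthonormal_cells cs E" and "p \<in> jordan_index cs" "q \<in> jordan_index cs"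
  shows "b (E p) (case q of (n, i) \<Rightarrow> E (n, Suc (fst (cs ! n)) - i)) = (if p = q then 1 else 0)"
proof -
  obtain n i n' j where [simp]: "p = (n, i)" "q = (n', j)" by (cases p, cases q)
  have "(n', Suc (fst (cs ! n')) - j) \<in> jordan_index cs"
    using assms(3) by (auto simp: jordan_index_def)
  then have "b (E p) (E (n', Suc (fst (cs ! n')) - j)) =
      (if n = n' \<and> i + (Suc (fst (cs ! n')) - j) = Suc (fst (cs ! n)) then 1 else 0)"
    using cells assms(2) by (simp add: orthonormal_cells_def)
  also have "\<dots> = (if p = q then 1 else 0)"
    using assms(2,3) by (auto simp: jordan_index_def)
  finally show ?thesis by simp
qed

theorem ex_orthonormal_jordan_basis:
  "\<exists>cs E. orthonormal_cells cs E \<and> jordan_basis u cs E"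
proof -
  obtain cs E where cells: "orthonormal_cells cs E" and sp: "span (E ` jordan_index cs) = UNIV"
    using ex_orthonormal_cells[of UNIV] form_nondegenerate by auto
  let ?I = "jordan_index cs"
  have fin: "finite ?I" by (simp add: jordan_index_def)
  define E' where "E' = (\<lambda>(n, i). E (n, Suc (fst (cs ! n)) - i))"
  have dual: "b (E p) (E' q) = (if p = q then 1 else 0)" if "p \<in> ?I" "q \<in> ?I" for p q
    unfolding E'_def by (rule orthonormal_cells_dual[OF cells that])
  have inj: "inj_on E ?I"
    by (rule inj_onI) (use dual in \<open>metis zero_neq_one\<close>)
  have "independent (E ` ?I)"
  proof (rule independent_if_scalars_zero)
    fix f x assume s: "(\<Sum>x\<in>E ` ?I. f x *s x) = 0" and "x \<in> E ` ?I"
    then obtain q where q: "q \<in> ?I" "x = E q" by blast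
    have "b (\<Sum>p\<in>?I. f (E p) *s E p) (E' q) = 0"
      using s by (simp add: sum.reindex[OF inj] form_rules)
    also have "b (\<Sum>p\<in>?I. f (E p) *s E p) (E' q) = (\<Sum>p\<in>?I. if p = q then f x else 0)"
      unfolding form_rules by (intro sum.cong) (auto simp: dual q)
    finally show "f x = 0" using q fin by simp
  qed (simp add: fin)
  then have "jordan_basis u cs E"
    using cells sp fin inj
    by (simp add: orthonormal_cells_def jordan_basis_def indexed_basis_def)
  then show ?thesis using cells by blast
qed

end

section \<open>Counting Jordan cells\<close>

text \<open>
  This is the dimension of the kernel of \<open>(u - c)^k\<close> for an endomorphism \<open>u\<close> whose Jordan cells
  are listed in \<open>cs\<close>.
\<close>

definition kernel_dim :: "(nat \<times> 'a) list \<Rightarrow> 'a \<Rightarrow> nat \<Rightarrow> nat"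
  where "kernel_dim cs c k = (\<Sum>(m, a)\<leftarrow>cs. if a = c then min k m else 0)"

text \<open>
  The second difference of \<open>k \<mapsto> min k m\<close> vanishes except at \<open>k = m\<close>.
\<close>

lemma count_list_kernel_dim:
  "count_list cs (Suc k, c) + kernel_dim cs c (Suc (Suc k)) + kernel_dim cs c k
    = 2 * kernel_dim cs c (Suc k)"
proof (induction cs)
  case (Cons p cs)
  obtain m a where "p = (m, a)" by (cases p)
  then show ?case
    using Cons by (cases "a = c"; cases "m = Suc k") (auto simp: kernel_dim_def min_def)
qed (simp add: kernel_dim_def)

lemma count_list_eq_if_kernel_dim_eq:
  assumes "\<And>k. kernel_dim cs c k = kernel_dim ds d k"
  shows "count_list cs (Suc k, c) = count_list ds (Suc k, d)"
  using count_list_kernel_dim[of cs k c] count_list_kernel_dim[of ds k d] assms by simp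

lemma kernel_dim_card:
  "kernel_dim cs c k = card {(n, i)\<in>jordan_index cs. snd (cs ! n) = c \<and> i \<le> k}"
proof -
  have "{(n, i)\<in>jordan_index cs. snd (cs ! n) = c \<and> i \<le> k}
      = (SIGMA n:{n. n < length cs \<and> snd (cs ! n) = c}. {1..min k (fst (cs ! n))})"
    by (auto simp: jordan_index_def)
  also have "card \<dots> = (\<Sum>n | n < length cs \<and> snd (cs ! n) = c. min k (fst (cs ! n)))"
    by (subst card_SigmaI) auto
  also have "\<dots> = (\<Sum>n<length cs. if snd (cs ! n) = c then min k (fst (cs ! n)) else 0)"
    by (rule sum.mono_neutral_cong_left) auto
  also have "\<dots> = kernel_dim cs c k"
    unfolding kernel_dim_def sum_list_sum_nth
    by (rule sum.cong) (auto simp: case_prod_unfold)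
  finally show ?thesis ..
qed

lemma jordan_index_Cons:
  "jordan_index ((m, a) # cs) = {0} \<times> {1..m} \<union> (\<lambda>(n, i). (Suc n, i)) ` jordan_index cs"
proof -
  have "(n, i) \<in> jordan_index ((m, a) # cs) \<longleftrightarrow>
      (n, i) \<in> {0} \<times> {1..m} \<union> (\<lambda>(n, i). (Suc n, i)) ` jordan_index cs" for n i
    by (cases n) (auto simp: jordan_index_def image_iff Bex_def)
  then show ?thesis by auto
qed

text \<open>
  The function \<open>pos\<close> numbers the pairs of a cell and a place in this cell in the order in which they
  occur along the diagonal of the block matrix.
\<close>

lemma jordan_matrix_entries:
  fixes cs :: "(nat \<times> 'a::field) list"
  shows "\<exists>pos. bij_betw pos (jordan_index cs) {..<sum_list (map fst cs)} \<and>
    (\<forall>n i r. (n, i) \<in> jordan_index cs \<longrightarrow> r < sum_list (map fst cs) \<longrightarrow>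
      jordan_matrix cs $$ (r, pos (n, i)) =
        (if r = pos (n, i) then snd (cs ! n) else if 2 \<le> i \<and> r = pos (n, i - 1) then 1 else 0))"
proof (induction cs)
  case Nil
  show ?case by (intro exI[of _ "\<lambda>_. 0"]) (auto simp: jordan_index_def bij_betw_def)
next
  case (Cons p cs)
  obtain m a where p: "p = (m, a)" by (cases p)
  let ?d = "sum_list (map fst cs)"
  obtain pos where bij: "bij_betw pos (jordan_index cs) {..<?d}"
    and ent: "\<And>n i r. (n, i) \<in> jordan_index cs \<Longrightarrow> r < ?d \<Longrightarrow> jordan_matrix cs $$ (r, pos (n, i)) =
        (if r = pos (n, i) then snd (cs ! n) else if 2 \<le> i \<and> r = pos (n, i - 1) then 1 else 0)"
    using Cons.IH by blast
  let ?sh = "\<lambda>(n, i). (Suc n, i :: nat)"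
  define pos' where "pos' = (\<lambda>(n, i). case n of 0 \<Rightarrow> i - 1 | Suc n' \<Rightarrow> m + pos (n', i))"
  have lt: "pos q < ?d" if "q \<in> jordan_index cs" for q
    using bij that by (auto simp: bij_betw_def)
  have "bij_betw pos' ({0} \<times> {1..m}) {..<m}"
    by (rule bij_betw_byWitness[of _ "\<lambda>r. (0, Suc r)"]) (auto simp: pos'_def)
  moreover have "bij_betw pos' (?sh ` jordan_index cs) {m..<m + ?d}"
  proof (rule bij_betw_imageI)
    show "inj_on pos' (?sh ` jordan_index cs)"
      using bij by (auto simp: bij_betw_def pos'_def intro!: inj_onI dest: inj_onD)
    have "pos' ` ?sh ` jordan_index cs = (+) m ` pos ` jordan_index cs"
      unfolding image_image by (rule image_cong) (auto simp: pos'_def)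
    also have "\<dots> = {m..<m + ?d}"
      using bij image_add_atLeastLessThan[of m 0 ?d]
      by (simp add: bij_betw_def lessThan_atLeast0 add.commute)
    finally show "pos' ` ?sh ` jordan_index cs = {m..<m + ?d}" .
  qed
  ultimately have "bij_betw pos' (jordan_index (p # cs)) ({..<m} \<union> {m..<m + ?d})"
    unfolding p jordan_index_Cons by (rule bij_betw_combine) auto
  moreover have "{..<m} \<union> {m..<m + ?d} = {..<sum_list (map fst (p # cs))}" by (auto simp: p)
  moreover have "jordan_matrix (p # cs) $$ (r, pos' (n, i)) =
      (if r = pos' (n, i) then snd ((p # cs) ! n) else if 2 \<le> i \<and> r = pos' (n, i - 1) then 1 else 0)"
    if ni: "(n, i) \<in> jordan_index (p # cs)" and r: "r < sum_list (map fst (p # cs))" for n i r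
  proof (cases n)
    case 0
    then have "i \<in> {1..m}" using ni by (auto simp: jordan_index_def p)
    with 0 show ?thesis using r by (auto simp: p jordan_matrix_Cons pos'_def)
  next
    case (Suc n')
    then have q: "(n', i) \<in> jordan_index cs" using ni by (auto simp: jordan_index_def)
    then have "2 \<le> i \<Longrightarrow> (n', i - 1) \<in> jordan_index cs" by (auto simp: jordan_index_def)
    then show ?thesis
      using Suc r lt[OF q] ent[OF q, of "r - m"] lt[of "(n', i - 1)"]
      by (auto simp: p jordan_matrix_Cons pos'_def)
  qed
  ultimately show ?case by (intro exI[of _ pos']) auto
qed

context finite_dimensional_vector_space
begin

lemma in_span_subfamily_iff:
  assumes basis: "indexed_basis I E" and A: "A \<subseteq> I" and "coordinates I E X"
  shows "x \<in> span (E ` A) \<longleftrightarrow> (\<forall>i\<in>I - A. X i x = 0)"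
proof
  note X = coordinatesD[OF assms(3)]
  assume "x \<in> span (E ` A)"
  then show "\<forall>i\<in>I - A. X i x = 0"
  proof (induction rule: span_induct_alt)
    case base
    then show ?case using X(2)[of _ 0 0] by auto
  next
    case (step c x y)
    then show ?case using A by (auto simp: X)
  qed
next
  note X = coordinatesD[OF assms(3)]
  assume 0: "\<forall>i\<in>I - A. X i x = 0"
  have fin: "finite I" using basis by (simp add: indexed_basis_def)
  have "x = (\<Sum>i\<in>A. X i x *s E i)"
    by (subst X(4)[of x], rule sum.mono_neutral_right) (use fin A 0 in auto)
  also have "\<dots> \<in> span (E ` A)" by (intro span_sum span_scale span_base) auto
  finally show "x \<in> span (E ` A)" .
qed

text \<open>
  In coordinates \<open>X\<close> with respect to \<open>E\<close>, the entry of \<open>(u - c) x\<close> at \<open>(n, i)\<close> is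
  \<open>(c' - c) * X (n, i) x + X (n, i + 1) x\<close>, where \<open>c'\<close> is the eigenvalue of the cell and the last term
  is dropped at the end of the cell. If \<open>(u - c) x\<close> has no entries outside the claimed span for \<open>k\<close>,
  then \<open>x\<close> has none outside the one for \<open>k + 1\<close>: for \<open>c' = c\<close> the entries of \<open>(u - c) x\<close> are those of
  \<open>x\<close>, shifted by one place, and for \<open>c' \<noteq> c\<close> the entries of \<open>x\<close> vanish successively from the end of
  the cell.
\<close>

lemma generalised_kernel_eq_span:
  assumes u: "endo u" and jb: "jordan_basis u cs E"
  shows "{x. ((\<lambda>y. u y - c *s y) ^^ k) x = 0} =
    span (E ` {(n, i)\<in>jordan_index cs. snd (cs ! n) = c \<and> i \<le> k})"
proof (induction k)
  case 0
  have "{(n, i)\<in>jordan_index cs. snd (cs ! n) = c \<and> i \<le> 0} = {}"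
    by (auto simp: jordan_index_def)
  then show ?case by (simp only: image_empty span_empty) auto
next
  case (Suc k)
  let ?T = "\<lambda>y. u y - c *s y" and ?J = "jordan_index cs"
  let ?A = "\<lambda>k. {(n, i)\<in>?J. snd (cs ! n) = c \<and> i \<le> k}"
  have T: "endo ?T" by (rule endoI) (auto simp: endo_simps[OF u] algebra_simps)
  have basis: "indexed_basis ?J E" and E0: "E (n, 0) = 0"
    and rel: "(n, i) \<in> ?J \<Longrightarrow> u (E (n, i)) = snd (cs ! n) *s E (n, i) + E (n, i - 1)" for n i
    using jb by (auto simp: jordan_basis_def)
  obtain X where co: "coordinates ?J E X"
    using ex_coordinates[OF basis] by blast
  note X = coordinatesD[OF co]
  have X0: "X q 0 = 0" if "q \<in> ?J" for q using X(2)[OF that, of 0 0] by simp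
  have XT: "X (n, i) (?T x) = (snd (cs ! n) - c) * X (n, i) x + (if i < fst (cs ! n) then X (n, Suc i) x else 0)"
    if ni: "(n, i) \<in> ?J" for n i x
  proof -
    have S: "(n, Suc i) \<in> ?J" if "i < fst (cs ! n)" using ni that by (auto simp: jordan_index_def)
    show ?thesis
    proof (induction x rule: indexed_basis_induct[OF basis])
      case 1
      then show ?case using X0[OF ni] X0[OF S] by (simp only: endo_0[OF T]) simp
    next
      case (2 x y)
      then show ?case using X(1)[OF ni] X(1)[OF S] by (simp only: endo_add[OF T]) (simp add: algebra_simps)
    next
      case (3 a x)
      then show ?case using X(2)[OF ni] X(2)[OF S] by (simp only: endo_scale[OF T]) (simp add: algebra_simps)
    next
      case (4 q)
      obtain m j where q: "q = (m, j)" by (cases q)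
      have "?T (E q) = (snd (cs ! m) - c) *s E (m, j) + E (m, j - 1)"
        using rel 4 by (simp add: q algebra_simps)
      moreover have "j - 1 = 0 \<and> j = 1 \<or> (m, j - 1) \<in> ?J" using 4 by (auto simp: q jordan_index_def)
      ultimately show ?case using 4 ni S
        by (auto simp: q X E0 X0 jordan_index_def)
    qed
  qed
  have mem: "x \<in> span (E ` ?A k) \<longleftrightarrow> (\<forall>i\<in>?J - ?A k. X i x = 0)" for k x
    by (rule in_span_subfamily_iff[OF basis _ co]) auto
  have "x \<in> span (E ` ?A (Suc k))" if "(?T ^^ Suc k) x = 0" for x
  proof -
    have "?T x \<in> span (E ` ?A k)"
      using that Suc.IH by (auto simp: funpow_Suc_right simp del: funpow.simps)
    then have TX: "X (n, i) (?T x) = 0" if "(n, i) \<in> ?J" "snd (cs ! n) \<noteq> c \<or> i > k" for n i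
      using that by (auto simp: mem)
    have "X (n, i) x = 0" if ni: "(n, i) \<in> ?J" "snd (cs ! n) \<noteq> c" for n i
      using ni
    proof (induction "fst (cs ! n) - i" arbitrary: i)
      case 0
      then show ?case using XT[of n i x] TX[of n i]
        by (auto simp: jordan_index_def)
    next
      case (Suc d)
      then have "(n, Suc i) \<in> ?J" by (auto simp: jordan_index_def)
      then have "X (n, Suc i) x = 0" using Suc by auto
      then show ?case using XT[of n i x] TX[of n i] Suc.prems by (simp split: if_splits)
    qed
    moreover have "X (n, i) x = 0" if ni: "(n, i) \<in> ?J" "snd (cs ! n) = c" "i > Suc k" for n i
    proof -
      have "(n, i - 1) \<in> ?J" "i - 1 < fst (cs ! n)" using ni by (auto simp: jordan_index_def)
      then show ?thesis using XT[of n "i - 1" x] TX[of n "i - 1"] ni by auto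
    qed
    ultimately show ?thesis unfolding mem by fastforce
  qed
  moreover have "span (E ` ?A (Suc k)) \<subseteq> {x. (?T ^^ Suc k) x = 0}"
  proof (rule span_minimal)
    have F: "endo (?T ^^ Suc k)" by (rule endo_funpow[OF T])
    show "subspace {x. (?T ^^ Suc k) x = 0}"
      unfolding subspace_def by (simp del: funpow.simps add: endo_simps[OF F])
    have "(?T ^^ Suc k) (E (n, i)) = 0" if ni: "(n, i) \<in> ?A (Suc k)" for n i
    proof -
      have "?T (E (n, i)) = E (n, i - 1)" using ni rel by auto
      moreover have "i - 1 = 0 \<or> (n, i - 1) \<in> ?A k" using ni by (auto simp: jordan_index_def)
      ultimately have "?T (E (n, i)) \<in> span (E ` ?A k)" using E0 by (auto intro: span_base span_zero)
      then show ?thesis using Suc.IH by (auto simp: funpow_Suc_right simp del: funpow.simps)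
    qed
    then show "E ` ?A (Suc k) \<subseteq> {x. (?T ^^ Suc k) x = 0}" by auto
  qed
  ultimately show ?case by blast
qed

lemma dim_generalised_kernel:
  assumes u: "endo u" and jb: "jordan_basis u cs E"
  shows "dim {x. ((\<lambda>y. u y - c *s y) ^^ k) x = 0} = kernel_dim cs c k"
proof -
  let ?A = "{(n, i)\<in>jordan_index cs. snd (cs ! n) = c \<and> i \<le> k}"
  have sub: "?A \<subseteq> jordan_index cs" by auto
  have ind: "independent (E ` ?A)" and inj: "inj_on E ?A"
    using jb sub independent_mono[of "E ` jordan_index cs" "E ` ?A"]
    by (auto simp: jordan_basis_def indexed_basis_def intro: inj_on_subset)
  show ?thesis
    unfolding generalised_kernel_eq_span[OF assms] kernel_dim_card dim_span
      dim_eq_card_independent[OF ind] card_image[OF inj] ..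
qed


lemma sum_vectors_matrix_mult:
  fixes M N :: "'a mat" and v :: "nat \<Rightarrow> 'b"
  assumes "M \<in> carrier_mat d d" "N \<in> carrier_mat d d" "j < d"
  shows "(\<Sum>l<d. (M * N) $$ (l, j) *s v l) = (\<Sum>r<d. N $$ (r, j) *s (\<Sum>l<d. M $$ (l, r) *s v l))"
proof -
  have "(M * N) $$ (l, j) = (\<Sum>r<d. M $$ (l, r) * N $$ (r, j))" if "l < d" for l
    using assms that by (simp add: scalar_prod_def lessThan_atLeast0)
  then have "(\<Sum>l<d. (M * N) $$ (l, j) *s v l) = (\<Sum>l<d. \<Sum>r<d. (M $$ (l, r) * N $$ (r, j)) *s v l)"
    by (simp add: scale_sum_left)
  also have "\<dots> = (\<Sum>r<d. \<Sum>l<d. (M $$ (l, r) * N $$ (r, j)) *s v l)" by (rule sum.swap)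
  finally show ?thesis by (simp add: scale_sum_right mult.commute)
qed

text \<open>
  Read in the order given by \<open>jordan_matrix_entries\<close>, a Jordan basis represents \<open>u\<close> by the Jordan
  matrix itself.
\<close>

lemma jordan_basis_imp_endo_jordan_nf:
  assumes jb: "jordan_basis u cs E"
  shows "endo_jordan_nf scale u cs"
proof -
  let ?J = "jordan_index cs" and ?d = "sum_list (map fst cs)"
  obtain pos where bij: "bij_betw pos ?J {..<?d}"
    and ent: "\<And>n i r. (n, i) \<in> ?J \<Longrightarrow> r < ?d \<Longrightarrow> jordan_matrix cs $$ (r, pos (n, i)) =
        (if r = pos (n, i) then snd (cs ! n) else if 2 \<le> i \<and> r = pos (n, i - 1) then 1 else 0)"
    using jordan_matrix_entries[of cs] by blast
  define q where "q = inv_into ?J pos"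
  have q: "q r \<in> ?J" "pos (q r) = r" if "r < ?d" for r
    using bij that bij_betw_inv_into_right[OF bij] bij_betw_apply[OF bij_betw_inv_into[OF bij]]
    by (auto simp: q_def)
  have qpos: "q (pos p) = p" "pos p < ?d" if "p \<in> ?J" for p
    using bij_betw_inv_into_left[OF bij that] bij_betw_apply[OF bij that] by (auto simp: q_def)
  have ind: "independent (E ` ?J)" and sp: "span (E ` ?J) = UNIV" and inj: "inj_on E ?J"
    and E0: "E (n, 0) = 0" and cs0: "0 \<notin> fst ` set cs"
    and rel: "(n, i) \<in> ?J \<Longrightarrow> u (E (n, i)) = snd (cs ! n) *s E (n, i) + E (n, i - 1)" for n i
    using jb by (auto simp: jordan_basis_def indexed_basis_def)
  define bs where "bs = map (\<lambda>r. E (q r)) [0..<?d]"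
  have len: "length bs = ?d" and nth: "r < ?d \<Longrightarrow> bs ! r = E (q r)" for r
    by (auto simp: bs_def)
  have "q ` {..<?d} = ?J"
    unfolding q_def by (rule bij_betw_imp_surj_on[OF bij_betw_inv_into[OF bij]])
  then have set: "set bs = E ` ?J" by (auto simp: bs_def image_image[symmetric] lessThan_atLeast0)
  have "inj_on (\<lambda>r. E (q r)) {..<?d}"
    using q inj by (intro inj_onI) (metis inj_onD lessThan_iff)
  then have "distinct bs" by (auto simp: bs_def distinct_map lessThan_atLeast0)
  then have "ordered_basis scale bs"
    using ind sp set by (simp add: ordered_basis_def)
  moreover have "endo_matrix scale bs u = jordan_matrix cs"
  proof (rule eq_matI)
    fix r s assume "r < dim_row (jordan_matrix cs)" "s < dim_col (jordan_matrix cs)"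
    then have rs: "r < ?d" "s < ?d" by simp_all
    obtain n i where ni: "q s = (n, i)" by (cases "q s")
    obtain n' i' where ni': "q r = (n', i')" by (cases "q r")
    have J: "(n, i) \<in> ?J" "pos (n, i) = s" "(n', i') \<in> ?J" "pos (n', i') = r"
      using q[OF rs(2)] q[OF rs(1)] ni ni' by auto
    let ?R = "\<lambda>x. representation (E ` ?J) x (E (n', i'))"
    have R: "?R (E p) = (if p = (n', i') then 1 else 0)" if "p \<in> ?J" for p
      using representation_basis[OF ind, of "E p"] that J(3) inj by (auto dest: inj_onD)
    have R1: "?R (E (n, i - 1)) = (if 2 \<le> i \<and> r = pos (n, i - 1) then 1 else 0)"
    proof (cases "2 \<le> i")
      case True
      then have "(n, i - 1) \<in> ?J" using J(1) by (auto simp: jordan_index_def)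
      then show ?thesis using True R[of "(n, i - 1)"] J(3,4) qpos by metis
    next
      case False
      then have "i - 1 = 0" by simp
      then show ?thesis using False E0[of n] by (simp add: representation_zero)
    qed
    have "endo_matrix scale bs u $$ (r, s) = ?R (u (E (n, i)))"
      using rs by (simp add: endo_matrix_def len nth set ni ni')
    also have "\<dots> = snd (cs ! n) * ?R (E (n, i)) + ?R (E (n, i - 1))"
      by (simp add: rel[OF J(1)] representation_add representation_scale ind sp)
    also have "\<dots> = (if r = s then snd (cs ! n) else 0) + (if 2 \<le> i \<and> r = pos (n, i - 1) then 1 else 0)"
      unfolding R1 using R[OF J(1)] J ni ni' by auto
    also have "\<dots> = jordan_matrix cs $$ (r, s)"
    proof -
      have "\<not> (2 \<le> i \<and> s = pos (n, i - 1))"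
      proof
        assume i: "2 \<le> i \<and> s = pos (n, i - 1)"
        then have "(n, i - 1) \<in> ?J" using J(1) by (auto simp: jordan_index_def)
        then have "(n, i) = (n, i - 1)" using i J qpos by metis
        then have "i = i - 1" by (simp only: prod.inject)
        then show False using i by linarith
      qed
      then show ?thesis using ent[OF J(1) rs(1)] J(2) by auto
    qed
    finally show "endo_matrix scale bs u $$ (r, s) = jordan_matrix cs $$ (r, s)" .
  qed (simp_all add: endo_matrix_def len)
  ultimately show ?thesis
    using cs0 similar_mat_refl[OF jordan_matrix_carrier[of cs]]
    unfolding endo_jordan_nf_def jordan_nf_def by metis
qed

text \<open>
  If \<open>A P = P K\<close> for the matrix \<open>A\<close> of \<open>u\<close>, a Jordan matrix \<open>K\<close> and an invertible \<open>P\<close>, then the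
  vectors \<open>w\<close> with the columns of \<open>P\<close> as coordinates satisfy the relations of a Jordan basis; they
  span because \<open>P Q = 1\<close>.
\<close>

lemma endo_jordan_nf_imp_jordan_basis:
  assumes u: "endo u" and nf: "endo_jordan_nf scale u cs"
  shows "\<exists>E. jordan_basis u cs E"
proof -
  let ?J = "jordan_index cs"
  obtain bs where bs: "ordered_basis scale bs" and "jordan_nf (endo_matrix scale bs u) cs"
    using nf by (auto simp: endo_jordan_nf_def)
  define A where "A = endo_matrix scale bs u"
  define d where "d = length bs"
  have cs0: "0 \<notin> fst ` set cs" and sim: "similar_mat A (jordan_matrix cs)"
    using \<open>jordan_nf _ cs\<close> by (auto simp: jordan_nf_def A_def)
  have Ad: "A \<in> carrier_mat d d" by (simp add: A_def endo_matrix_def d_def)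
  obtain P Q where PQ: "similar_mat_wit A (jordan_matrix cs) P Q"
    using sim by (auto simp: similar_mat_def)
  have mats: "P \<in> carrier_mat d d" "Q \<in> carrier_mat d d" "jordan_matrix cs \<in> carrier_mat d d"
    "P * Q = 1\<^sub>m d" "Q * P = 1\<^sub>m d" "A = P * jordan_matrix cs * Q"
    using PQ Ad by (auto simp: similar_mat_wit_def Let_def)
  let ?K = "jordan_matrix cs"
  have d: "sum_list (map fst cs) = d" using mats(3) by auto
  have AP: "A * P = P * ?K"
  proof -
    have "A * P = P * ?K * (Q * P)"
      unfolding mats(6) by (rule assoc_mult_mat[OF mult_carrier_mat[OF mats(1,3)] mats(2,1)])
    then show ?thesis
      by (simp only: mats(5) right_mult_one_mat[OF mult_carrier_mat[OF mats(1,3)]])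
  qed
  define v where "v i = bs ! i" for i
  have ub: "u (v j) = (\<Sum>l<d. A $$ (l, j) *s v l)" if "j < d" for j
  proof -
    have "u (v j) = (\<Sum>x\<in>set bs. representation (set bs) (u (v j)) x *s x)"
      using bs by (intro sum_representation_eq[symmetric]) (auto simp: ordered_basis_def)
    also have "\<dots> = (\<Sum>l<d. representation (set bs) (u (v j)) (v l) *s v l)"
      unfolding v_def d_def
      using bij_betw_nth[of bs "{..<length bs}" "set bs"] bs
      by (intro sum.reindex_bij_betw[symmetric]) (auto simp: ordered_basis_def)
    also have "\<dots> = (\<Sum>l<d. A $$ (l, j) *s v l)"
      using that by (intro sum.cong) (auto simp: A_def endo_matrix_def d_def v_def)
    finally show ?thesis .
  qed
  define w where "w j = (\<Sum>l<d. P $$ (l, j) *s v l)" for j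
  have uw: "u (w j) = (\<Sum>r<d. ?K $$ (r, j) *s w r)" if "j < d" for j
  proof -
    have "u (w j) = (\<Sum>i<d. P $$ (i, j) *s (\<Sum>l<d. A $$ (l, i) *s v l))"
      unfolding w_def by (simp add: endo_simps[OF u] ub)
    also have "\<dots> = (\<Sum>l<d. (A * P) $$ (l, j) *s v l)"
      by (rule sum_vectors_matrix_mult[symmetric]) (use Ad mats that in auto)
    also have "\<dots> = (\<Sum>r<d. ?K $$ (r, j) *s w r)"
      unfolding AP w_def by (rule sum_vectors_matrix_mult) (use mats that in auto)
    finally show ?thesis .
  qed
  have vw: "v i = (\<Sum>r<d. Q $$ (r, i) *s w r)" if "i < d" for i
  proof -
    have "(\<Sum>l<d. (P * Q) $$ (l, i) *s v l) = (\<Sum>l<d. if l = i then v i else 0)"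
      using that by (intro sum.cong) (auto simp: mats(4))
    also have "\<dots> = v i" using that by simp
    finally show ?thesis
      unfolding w_def using sum_vectors_matrix_mult[OF mats(1,2) that, of v] by simp
  qed
  obtain pos where bij: "bij_betw pos ?J {..<d}"
    and ent: "\<And>n i r. (n, i) \<in> ?J \<Longrightarrow> r < d \<Longrightarrow> ?K $$ (r, pos (n, i)) =
        (if r = pos (n, i) then snd (cs ! n) else if 2 \<le> i \<and> r = pos (n, i - 1) then 1 else 0)"
    using jordan_matrix_entries[of cs] unfolding d by blast
  have posJ: "pos p < d" if "p \<in> ?J" for p
    using bij_betw_apply[OF bij that] by simp
  define E where "E = (\<lambda>(n, i). if i = 0 then 0 else w (pos (n, i)))"
  have "E ` ?J = w ` {..<d}"
  proof -
    have "E ` ?J = w ` pos ` ?J"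
      unfolding image_image by (rule image_cong) (auto simp: E_def jordan_index_def)
    then show ?thesis using bij by (simp add: bij_betw_def)
  qed
  moreover have "span (w ` {..<d}) = UNIV"
  proof -
    have "set bs \<subseteq> span (w ` {..<d})"
    proof
      fix x assume "x \<in> set bs"
      then obtain i where i: "i < d" "x = v i" by (auto simp: in_set_conv_nth d_def v_def)
      show "x \<in> span (w ` {..<d})"
        unfolding i(2) vw[OF i(1)] by (intro span_sum span_scale span_base) auto
    qed
    then have "span (set bs) \<subseteq> span (w ` {..<d})" by (intro span_minimal) auto
    then show ?thesis using bs by (auto simp: ordered_basis_def)
  qed
  moreover have "card ?J = dim UNIV"
  proof -
    have "card ?J = d" using bij_betw_same_card[OF bij] by simp
    also have "\<dots> = card (set bs)" using bs by (simp add: d_def distinct_card ordered_basis_def)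
    also have "\<dots> = dim UNIV"
      using bs by (metis dim_eq_card_independent dim_span ordered_basis_def)
    finally show ?thesis .
  qed
  moreover have "finite ?J" by (simp add: jordan_index_def)
  ultimately have "indexed_basis ?J E" by (intro indexed_basis_if_spanning) auto
  moreover have "u (E (n, i)) = snd (cs ! n) *s E (n, i) + E (n, i - 1)" if ni: "(n, i) \<in> ?J" for n i
  proof -
    have i: "i \<noteq> 0" using ni by (auto simp: jordan_index_def)
    have "u (E (n, i)) = (\<Sum>r<d. ?K $$ (r, pos (n, i)) *s w r)"
      using uw[OF posJ[OF ni]] i by (simp add: E_def)
    also have "\<dots> = (\<Sum>r<d. (if r = pos (n, i) then snd (cs ! n) *s w r else 0)
        + (if r = pos (n, i - 1) then E (n, i - 1) else 0))"
    proof (rule sum.cong)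
      fix r assume "r \<in> {..<d}"
      show "?K $$ (r, pos (n, i)) *s w r = (if r = pos (n, i) then snd (cs ! n) *s w r else 0)
        + (if r = pos (n, i - 1) then E (n, i - 1) else 0)"
      proof (cases "2 \<le> i")
        case True
        then have "(n, i - 1) \<in> ?J" using ni by (auto simp: jordan_index_def)
        then have "pos (n, i - 1) \<noteq> pos (n, i)"
          using ni True bij by (auto simp: bij_betw_def dest: inj_onD)
        then show ?thesis using ent[OF ni] \<open>r \<in> _\<close> True by (auto simp: E_def)
      next
        case False
        then show ?thesis using ent[OF ni] \<open>r \<in> _\<close> by (auto simp: E_def)
      qed
    qed simp
    also have "\<dots> = snd (cs ! n) *s w (pos (n, i)) + (if pos (n, i - 1) < d then E (n, i - 1) else 0)"
      using posJ[OF ni] by (simp add: sum.distrib)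
    also have "\<dots> = snd (cs ! n) *s E (n, i) + E (n, i - 1)"
    proof -
      have "i - 1 = 0 \<or> (n, i - 1) \<in> ?J" using ni by (auto simp: jordan_index_def)
      then show ?thesis using posJ[of "(n, i - 1)"] i by (auto simp: E_def)
    qed
    finally show ?thesis .
  qed
  ultimately have "jordan_basis u cs E" using cs0 by (auto simp: jordan_basis_def E_def)
  then show ?thesis by blast
qed

text \<open>
  The list chosen in the definition of \<open>jordan_cells\<close> comes with a Jordan basis too, and both lists
  compute the same kernel dimensions.
\<close>

theorem jordan_cells_eq_count_list:
  assumes "endo u" "jordan_basis u cs E" "k \<ge> 1"
  shows "jordan_cells scale u c k = count_list cs (k, c)"
proof -
  define ds where "ds = (SOME ds. endo_jordan_nf scale u ds)"
  have "endo_jordan_nf scale u ds"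
    unfolding ds_def using jordan_basis_imp_endo_jordan_nf[OF assms(2)] by (rule someI)
  then obtain F where F: "jordan_basis u ds F"
    using endo_jordan_nf_imp_jordan_basis[OF assms(1)] by blast
  have "count_list ds (Suc (k - 1), c) = count_list cs (Suc (k - 1), c)"
    by (rule count_list_eq_if_kernel_dim_eq)
      (simp only: dim_generalised_kernel[OF assms(1,2), symmetric]
        dim_generalised_kernel[OF assms(1) F, symmetric])
  then show ?thesis using assms(3) by (simp add: jordan_cells_def ds_def)
qed

section \<open>Similarity of an endomorphism to its negative\<close>

text \<open>
  From \<open>g (u - c) = - (u + c) g\<close> it follows that \<open>g\<close> maps the first kernel into the second one.
\<close>

lemma dim_kernel_anticommuting:
  assumes u: "endo u" and g: "endo g" and anti: "\<And>x. g (u x) = - u (g x)"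
    and inj: "\<And>x. ((\<lambda>y. u y - c *s y) ^^ k) x = 0 \<Longrightarrow> g x = 0 \<Longrightarrow> x = 0"
  shows "dim {x. ((\<lambda>y. u y - c *s y) ^^ k) x = 0} \<le> dim {x. ((\<lambda>y. u y - (- c) *s y) ^^ k) x = 0}"
proof -
  let ?T = "\<lambda>c y. u y - c *s y"
  interpret pair: finite_dimensional_vector_space_pair_1 scale Basis scale by unfold_locales
  have lin: "endo (?T c ^^ k)" for c
    by (rule endo_funpow, rule endoI) (auto simp: endo_simps[OF u] algebra_simps)
  let ?K = "\<lambda>c. {x. (?T c ^^ k) x = 0}"
  have sub: "subspace (?K c)"
    by (simp add: subspace_def endo_simps[OF lin])
  have step: "?T (- c) (g x) = - g (?T c x)" for x
    by (simp add: endo_simps[OF g] anti)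
  have pow: "(?T (- c) ^^ k) (g x) = (if even k then 1 else - 1) *s g ((?T c ^^ k) x)" for k x
  proof (induction k)
    case (Suc k)
    have neg: "?T (- c) (a *s y) = a *s ?T (- c) y" for a y
      by (simp add: endo_simps[OF u] algebra_simps)
    have "(?T (- c) ^^ Suc k) (g x) = ?T (- c) ((if even k then 1 else - 1) *s g ((?T c ^^ k) x))"
      using Suc by simp
    also have "\<dots> = (if even k then 1 else - 1) *s - g ((?T c ^^ Suc k) x)"
      by (simp only: neg step funpow.simps comp_def)
    finally show ?case by simp
  qed simp
  have "inj_on g (span (?K c))"
    unfolding span_eq_iff[THEN iffD2, OF sub]
  proof (rule inj_onI)
    fix x y assume xy: "x \<in> ?K c" "y \<in> ?K c" "g x = g y"
    then have "x - y \<in> ?K c" using subspace_diff[OF sub] by blast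
    then show "x = y" using inj[of "x - y"] xy by (simp add: endo_simps[OF g])
  qed
  then have "dim (?K c) = dim (g ` ?K c)"
    using pair.dim_image_eq[OF g] by simp
  also have "\<dots> \<le> dim (?K (- c))"
    by (rule dim_subset) (use pow in \<open>auto simp: endo_0[OF g]\<close>)
  finally show ?thesis .
qed

text \<open>
  If the counts agree, some permutation \<open>p\<close> of the cells preserves sizes and negates eigenvalues, and
  \<open>E (n, i) \<mapsto> (-1)^i *s E (p n, i)\<close> conjugates \<open>u\<close> to \<open>-u\<close>. The sign is needed because negation
  also changes the sign of the off-diagonal ones of a Jordan cell.
\<close>

lemma similar_neg_iff_count_list:
  assumes u: "endo u" and jb: "jordan_basis u cs E"
  shows "similar_endo scale u (\<lambda>x. - u x) \<longleftrightarrow>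
    (\<forall>k\<ge>1. \<forall>c. c \<noteq> 0 \<longrightarrow> count_list cs (k, c) = count_list cs (k, - c))"
proof
  assume "similar_endo scale u (\<lambda>x. - u x)"
  then obtain g where g: "endo g" "bij g" and gu: "g \<circ> u = (\<lambda>x. - u x) \<circ> g"
    by (auto simp: similar_endo_def)
  have anti: "g (u x) = - u (g x)" for x using fun_cong[OF gu, of x] by simp
  have g0: "g x = 0 \<Longrightarrow> x = 0" for x using g by (metis bij_pointE endo_0)
  have le: "kernel_dim cs c k \<le> kernel_dim cs (- c) k" for c k
    using dim_kernel_anticommuting[OF u g(1) anti, where c = c and k = k] g0
    by (simp only: dim_generalised_kernel[OF assms])
  have "kernel_dim cs c k = kernel_dim cs (- c) k" for c k
    using le[of c k] le[of "- c" k] by simp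
  then have "count_list cs (Suc k, c) = count_list cs (Suc k, - c)" for k c
    by (rule count_list_eq_if_kernel_dim_eq)
  then show "\<forall>k\<ge>1. \<forall>c. c \<noteq> 0 \<longrightarrow> count_list cs (k, c) = count_list cs (k, - c)"
    by (metis Suc_pred' less_eq_Suc_le One_nat_def)
next
  assume cnt: "\<forall>k\<ge>1. \<forall>c. c \<noteq> 0 \<longrightarrow> count_list cs (k, c) = count_list cs (k, - c)"
  let ?J = "jordan_index cs"
  have basis: "indexed_basis ?J E" and E0: "E (n, 0) = 0" and cs0: "0 \<notin> fst ` set cs"
    and rel: "(n, i) \<in> ?J \<Longrightarrow> u (E (n, i)) = snd (cs ! n) *s E (n, i) + E (n, i - 1)" for n i
    using jb by (auto simp: jordan_basis_def)
  let ?neg = "map (\<lambda>(m, a). (m, - a)) cs"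
  have cl: "count_list (map (\<lambda>(m, a). (m, - a)) ds) (m, a) = count_list ds (m, - a)" for ds :: "(nat \<times> 'a) list" and m a
    by (induction ds) auto
  have "mset ?neg = mset cs"
  proof (rule multiset_eqI)
    fix x :: "nat \<times> 'a"
    obtain m a where x: "x = (m, a)" by (cases x)
    have "count_list cs (m, - a) = count_list cs (m, a)"
    proof (cases "m = 0 \<or> a = 0")
      case True
      moreover have "count_list cs (0, e) = 0" for e
        using cs0 by (force simp: count_list_0_iff)
      ultimately show ?thesis by auto
    next
      case False
      then show ?thesis by (intro cnt[rule_format, symmetric]) auto
    qed
    then show "count (mset ?neg) x = count (mset cs) x"
      by (simp only: count_mset x cl)
  qed
  then obtain p where p: "p permutes {..<length cs}" "permute_list p cs = ?neg"
    by (rule mset_eq_permutation)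
  have csp: "p n < length cs" "cs ! p n = (fst (cs ! n), - snd (cs ! n))" if "n < length cs" for n
    using permutes_in_image[OF p(1)] that permute_list_nth[OF p(1) that] p(2)
    by (auto simp: case_prod_unfold)
  define q where "q = inv_into UNIV p"
  have pq: "p (q n) = n" "q (p n) = n" for n
    using permutes_inverses[OF p(1)] by (auto simp: q_def)
  have csq: "q n < length cs" "cs ! q n = (fst (cs ! n), - snd (cs ! n))" if "n < length cs" for n
  proof -
    show "q n < length cs" using permutes_in_image[OF permutes_inv[OF p(1)]] that by (auto simp: q_def)
    then show "cs ! q n = (fst (cs ! n), - snd (cs ! n))" using csp(2)[of "q n"] by (simp add: pq)
  qed
  have ex: "\<exists>g. endo g \<and> (\<forall>n i. (n, i) \<in> ?J \<longrightarrow> g (E (n, i)) = (- 1) ^ i *s E (r n, i))" for r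
    using indexed_basis_extend[OF basis, of "\<lambda>(n, i). (- 1) ^ i *s E (r n, i)"] by fast
  obtain g where g: "endo g" "\<And>n i. (n, i) \<in> ?J \<Longrightarrow> g (E (n, i)) = (- 1) ^ i *s E (p n, i)"
    using ex[of p] by blast
  obtain h where h: "endo h" "\<And>n i. (n, i) \<in> ?J \<Longrightarrow> h (E (n, i)) = (- 1) ^ i *s E (q n, i)"
    using ex[of q] by blast
  have J: "(p n, i) \<in> ?J" "(q n, i) \<in> ?J" if "(n, i) \<in> ?J" for n i
    using that csp[of n] csq[of n] by (auto simp: jordan_index_def)
  have sq: "(- 1) ^ i * (- 1) ^ i = (1 :: 'a)" for i
    by (simp flip: power_mult_distrib)
  have gh: "g (h x) = x" for x
  proof (rule indexed_basis_eqI[OF basis, of "\<lambda>x. g (h x)" "\<lambda>x. x"])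
    fix r assume "r \<in> ?J"
    then show "g (h (E r)) = E r"
      by (cases r) (simp add: g(2) h(2) J endo_simps[OF g(1)] sq pq)
  qed (auto intro!: endoI simp: endo_simps[OF g(1)] endo_simps[OF h(1)])
  have hg: "h (g x) = x" for x
  proof (rule indexed_basis_eqI[OF basis, of "\<lambda>x. h (g x)" "\<lambda>x. x"])
    fix r assume "r \<in> ?J"
    then show "h (g (E r)) = E r"
      by (cases r) (simp add: g(2) h(2) J endo_simps[OF h(1)] sq pq)
  qed (auto intro!: endoI simp: endo_simps[OF g(1)] endo_simps[OF h(1)])
  have "g (u x) = - u (g x)" for x
  proof (rule indexed_basis_eqI[OF basis, of "\<lambda>x. g (u x)" "\<lambda>x. - u (g x)"])
    fix r assume "r \<in> ?J"
    then obtain n i where r: "r = (n, i)" "(n, i) \<in> ?J" "n < length cs"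
      by (cases r) (auto simp: jordan_index_def)
    obtain j where j: "i = Suc j" using r(2) by (cases i) (auto simp: jordan_index_def)
    have "j = 0 \<or> (n, j) \<in> ?J" using r(2) by (auto simp: jordan_index_def j)
    then have "g (E (n, j)) = (- 1) ^ j *s E (p n, j)"
      using g(2) by (auto simp: E0 endo_0[OF g(1)])
    then have "g (u (E r)) = snd (cs ! n) *s (- 1) ^ i *s E (p n, i) + (- 1) ^ j *s E (p n, j)"
      using r by (simp add: rel g(2) endo_simps[OF g(1)] j)
    also have "\<dots> = - u (g (E r))"
    proof -
      have up: "u (E (p n, i)) = - snd (cs ! n) *s E (p n, i) + E (p n, j)"
        using rel[OF J(1)[OF r(2)]] csp[OF r(3)] by (simp add: j)
      have "u (g (E r)) = (- 1) ^ i *s u (E (p n, i))"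
        using r by (simp add: g(2) endo_simps[OF u])
      then show ?thesis by (simp add: up[unfolded j] j scale_right_distrib scale_right_diff_distrib scale_minus_left mult.commute)
    qed
    finally show "g (u (E r)) = - u (g (E r))" .
  qed (auto intro!: endoI simp: endo_simps[OF g(1)] endo_simps[OF u])
  moreover have "bij g" by (rule o_bij[of h]) (auto simp: gh hg)
  ultimately show "similar_endo scale u (\<lambda>x. - u x)"
    using g(1) by (auto simp: similar_endo_def intro!: exI[of _ g])
qed

end

section \<open>Pairing of Jordan cells\<close>

lemma card_remove_pair:
  assumes "finite C" "c \<in> C" "c' \<in> C" "c \<noteq> c'"
  shows "card {n\<in>C. P n} = card {n\<in>C - {c, c'}. P n} + of_bool (P c) + of_bool (P c')"
proof -
  have "{n\<in>C. P n} = {n\<in>C - {c, c'}. P n} \<union> ({n\<in>{c, c'}. P n})" using assms by auto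
  also have "card \<dots> = card {n\<in>C - {c, c'}. P n} + card {n\<in>{c, c'}. P n}"
    using assms(1) by (intro card_Un_disjoint) auto
  also have "card {n\<in>{c, c'}. P n} = of_bool (P c) + of_bool (P c')"
  proof -
    have "{n\<in>{c, c'}. P n} = (if P c then {c} else {}) \<union> (if P c' then {c'} else {})" by auto
    then show ?thesis using assms(4) by simp
  qed
  finally show ?thesis by simp
qed

text \<open>
  The pairs of cells (size, eigenvalue), and below the single cells, on which a selfadjoint \<open>d\<close> with
  \<open>u d = - d u\<close> and \<open>d d = - u u\<close> is constructed later on.
\<close>

definition matching_cells :: "nat \<times> 'a::field \<Rightarrow> nat \<times> 'a \<Rightarrow> bool"
  where "matching_cells p q \<longleftrightarrow> snd q = - snd p \<and>
    (fst p = fst q \<or> snd p = 0 \<and> odd (fst p) \<and> (fst p = fst q + 2 \<or> fst q = fst p + 2))"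

definition solitary_cell :: "nat \<times> 'a::field \<Rightarrow> bool"
  where "solitary_cell p \<longleftrightarrow> snd p = 0 \<and> (even (fst p) \<or> fst p = 1)"

definition cell_pairing :: "'c set \<Rightarrow> ('c \<Rightarrow> nat \<times> 'a::field) \<Rightarrow> ('c \<Rightarrow> 'c) \<Rightarrow> bool"
  where "cell_pairing C cell t \<longleftrightarrow> (\<forall>n\<in>C. t n \<in> C \<and> t (t n) = n \<and>
    (if t n = n then solitary_cell (cell n) else matching_cells (cell n) (cell (t n))))"

lemma matching_cells_sym: "matching_cells p q \<Longrightarrow> matching_cells q p"
  by (auto simp: matching_cells_def)

lemma cell_pairing_extend:
  assumes "cell_pairing (C - {c, c'}) cell t" "c \<in> C" "c' \<in> C"
    and "if c = c' then solitary_cell (cell c) else matching_cells (cell c) (cell c')"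
  shows "cell_pairing C cell (t(c := c', c' := c))"
  unfolding cell_pairing_def
proof
  fix n assume "n \<in> C"
  show "(t(c := c', c' := c)) n \<in> C \<and> (t(c := c', c' := c)) ((t(c := c', c' := c)) n) = n \<and>
      (if (t(c := c', c' := c)) n = n then solitary_cell (cell n)
       else matching_cells (cell n) (cell ((t(c := c', c' := c)) n)))"
  proof (cases "n \<in> {c, c'}")
    case True
    then show ?thesis using assms by (auto split: if_splits intro: matching_cells_sym)
  next
    case False
    then have "n \<in> C - {c, c'}" using \<open>n \<in> C\<close> by simp
    then have "t n \<in> C - {c, c'}" "t (t n) = n" "if t n = n then solitary_cell (cell n) else matching_cells (cell n) (cell (t n))"
      using assms(1) unfolding cell_pairing_def by blast+
    then show ?thesis using False by auto
  qed
qed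

text \<open>
  The two conditions of the classification, for a set of labelled cells instead of a list: in this
  form they survive the removal of cells.
\<close>

definition balanced_cells :: "'c set \<Rightarrow> ('c \<Rightarrow> nat \<times> 'a::field) \<Rightarrow> bool"
  where "balanced_cells C cell \<longleftrightarrow>
    (\<forall>m a. a \<noteq> 0 \<longrightarrow> card {n\<in>C. cell n = (m, a)} = card {n\<in>C. cell n = (m, - a)}) \<and>
    (\<forall>k. odd (card {n\<in>C. snd (cell n) = 0 \<and> odd (fst (cell n)) \<and> 2 * k + 1 < fst (cell n)}) \<longrightarrow>
      (\<exists>n\<in>C. cell n = (2 * k + 1, 0)))"

text \<open>
  Induction on the number of cells. A cell with nonzero eigenvalue has a partner by the first
  condition, and even cells for \<open>0\<close> stay alone. If only odd cells for \<open>0\<close> are left, take one of maximal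
  size \<open>2 k + 1\<close>. It is paired with a second one of this size if there is any. Otherwise the number
  of cells larger than \<open>2 k - 1\<close> is \<open>1\<close>, so for \<open>k > 0\<close> the second condition provides a partner of
  size \<open>2 k - 1\<close>; for \<open>k = 0\<close> the chosen cell is the only one. In each case the remaining cells are
  balanced again, because the removed cells do not affect the parity of the number of odd cells that
  are larger than a remaining odd size.
\<close>

lemma ex_cell_pairing:
  fixes cell :: "'c \<Rightarrow> nat \<times> 'a::field"
  assumes two: "(2::'a) \<noteq> 0" and fin: "finite C" and bal: "balanced_cells C cell"
  shows "\<exists>t. cell_pairing C cell t"
  using fin bal
proof (induction C rule: finite_psubset_induct)
  case (psubset C)
  let ?P = "\<lambda>k n. snd (cell n) = 0 \<and> odd (fst (cell n)) \<and> 2 * k + 1 < fst (cell n)"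
  have neg: "card {n\<in>C. cell n = (m, a)} = card {n\<in>C. cell n = (m, - a)}" if "a \<noteq> 0" for m a
    using psubset.prems that unfolding balanced_cells_def by blast
  have par: "\<exists>n\<in>C. cell n = (2 * k + 1, 0)" if "odd (card {n\<in>C. ?P k n})" for k
    using psubset.prems that unfolding balanced_cells_def by blast
  have reduce: ?case if red: "c \<in> C" "c' \<in> C" "balanced_cells (C - {c, c'}) cell"
    "if c = c' then solitary_cell (cell c) else matching_cells (cell c) (cell c')" for c c'
  proof -
    have "C - {c, c'} \<subset> C" using red by auto
    then obtain t where t: "cell_pairing (C - {c, c'}) cell t" using psubset.IH red(3) by blast
    show ?thesis using cell_pairing_extend[OF t red(1,2,4)] by blast
  qed
  have nz: "- a \<noteq> a" if "a \<noteq> 0" for a :: 'a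
  proof
    assume "- a = a"
    then have "2 * a = 0" by (metis add.right_inverse mult_2)
    then show False using two that by simp
  qed
  consider (empty) "C = {}"
    | (nonzero) c where "c \<in> C" "snd (cell c) \<noteq> 0"
    | (even) c where "c \<in> C" "snd (cell c) = 0" "even (fst (cell c))"
    | (odd) "C \<noteq> {}" "\<And>c. c \<in> C \<Longrightarrow> snd (cell c) = 0 \<and> odd (fst (cell c))"
    by blast
  then show ?case
  proof cases
    case empty
    then show ?thesis by (auto simp: cell_pairing_def)
  next
    case (nonzero c)
    obtain m a where c: "cell c = (m, a)" "a \<noteq> 0" using nonzero by (cases "cell c") auto
    have "c \<in> {n\<in>C. cell n = (m, a)}" using nonzero c by simp
    then have "card {n\<in>C. cell n = (m, a)} \<noteq> 0" using psubset.hyps by auto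
    then have "{n\<in>C. cell n = (m, - a)} \<noteq> {}" using neg[OF c(2)] by (metis card.empty)
    then obtain c' where c': "c' \<in> C" "cell c' = (m, - a)" by blast
    have ne: "c \<noteq> c'"
    proof
      assume "c = c'"
      then have "- a = a" using c(1) c'(2) by (metis snd_conv)
      then show False using nz[OF c(2)] by contradiction
    qed
    have card: "card {n\<in>C. P n} = card {n\<in>C - {c, c'}. P n} + of_bool (P c) + of_bool (P c')" for P
      by (rule card_remove_pair) (use psubset.hyps nonzero c' ne in auto)
    have "balanced_cells (C - {c, c'}) cell"
      unfolding balanced_cells_def
    proof (intro conjI allI impI)
      fix m' a' assume "a' \<noteq> (0::'a)"
      then have "card {n\<in>C. cell n = (m', a')} = card {n\<in>C. cell n = (m', - a')}" by (rule neg)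
      moreover have "cell c' = (m', - a') \<longleftrightarrow> cell c = (m', a')" using c c' by simp
      moreover have "cell c' = (m', a') \<longleftrightarrow> cell c = (m', - a')"
        unfolding c c' prod.inject by (metis minus_minus)
      ultimately show "card {n\<in>C - {c, c'}. cell n = (m', a')} = card {n\<in>C - {c, c'}. cell n = (m', - a')}"
        using card[of "\<lambda>n. cell n = (m', a')"] card[of "\<lambda>n. cell n = (m', - a')"] by simp
    next
      fix k assume o: "odd (card {n\<in>C - {c, c'}. ?P k n})"
      have "card {n\<in>C. ?P k n} = card {n\<in>C - {c, c'}. ?P k n}"
        using card[of "?P k"] c c' by simp
      with o obtain n where "n \<in> C" "cell n = (2 * k + 1, 0)" using par[of k] by auto
      then show "\<exists>n\<in>C - {c, c'}. cell n = (2 * k + 1, 0)"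
        using c c' by (intro bexI[of _ n]) auto
    qed
    then show ?thesis
      using reduce[of c c'] nonzero c c' ne by (simp add: matching_cells_def)
  next
    case (even c)
    have other: "{n\<in>C - {c}. cell n = (m, a)} = {n\<in>C. cell n = (m, a)}" if "a \<noteq> 0" for m a
      using even that by auto
    have "balanced_cells (C - {c}) cell"
      unfolding balanced_cells_def
    proof (intro conjI allI impI)
      fix m and a :: 'a assume a: "a \<noteq> 0"
      then have "- a \<noteq> 0" by simp
      show "card {n\<in>C - {c}. cell n = (m, a)} = card {n\<in>C - {c}. cell n = (m, - a)}"
        unfolding other[OF a] other[OF \<open>- a \<noteq> 0\<close>] by (rule neg[OF a])
    next
      fix k assume "odd (card {n\<in>C - {c}. ?P k n})"
      moreover have "{n\<in>C - {c}. ?P k n} = {n\<in>C. ?P k n}" using even by auto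
      ultimately obtain n where n: "n \<in> C" "cell n = (2 * k + 1, 0)" using par[of k] by auto
      moreover from n(2) have "odd (fst (cell n))" by simp
      then have "n \<noteq> c" using even(3) by blast
      ultimately show "\<exists>n\<in>C - {c}. cell n = (2 * k + 1, 0)" by blast
    qed
    then show ?thesis using reduce[of c c] even by (simp add: solitary_cell_def)
  next
    case odd
    let ?M = "Max ((\<lambda>n. fst (cell n)) ` C)"
    have fin: "finite ((\<lambda>n. fst (cell n)) ` C)" using psubset.hyps by simp
    have "?M \<in> (\<lambda>n. fst (cell n)) ` C" using Max_in[OF fin] odd(1) by blast
    then obtain c where c: "c \<in> C" "fst (cell c) = ?M" by (elim imageE) simp
    have le: "fst (cell n) \<le> fst (cell c)" if "n \<in> C" for n
      unfolding c(2) using that fin by (intro Max_ge) auto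
    obtain k where k: "fst (cell c) = 2 * k + 1" using odd(2)[OF c(1)] by (auto elim: oddE)
    have cc: "cell c = (2 * k + 1, 0)" using k odd(2)[OF c(1)] by (cases "cell c") auto
    have balanced: "balanced_cells (C - {c, c'}) cell"
      if par': "\<And>k. odd (card {n\<in>C - {c, c'}. ?P k n}) \<Longrightarrow> \<exists>n\<in>C - {c, c'}. cell n = (2 * k + 1, 0)" for c'
      unfolding balanced_cells_def
    proof (intro conjI allI impI)
      have empty: "{n\<in>C - {c, c'}. cell n = (m, a)} = {}" if "a \<noteq> 0" for m a
        using odd(2) that by fastforce
      fix m and a :: 'a assume a: "a \<noteq> 0"
      then have "- a \<noteq> 0" by simp
      show "card {n\<in>C - {c, c'}. cell n = (m, a)} = card {n\<in>C - {c, c'}. cell n = (m, - a)}"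
        unfolding empty[OF a] empty[OF \<open>- a \<noteq> 0\<close>] ..
    next
      fix k assume "odd (card {n\<in>C - {c, c'}. ?P k n})"
      then show "\<exists>n\<in>C - {c, c'}. cell n = (2 * k + 1, 0)" by (rule par')
    qed
    show ?thesis
    proof (cases "\<exists>c'\<in>C. c' \<noteq> c \<and> cell c' = cell c")
      case True
      then obtain c' where c': "c' \<in> C" "c' \<noteq> c" "cell c' = cell c" by blast
      have "\<exists>n\<in>C - {c, c'}. cell n = (2 * l + 1, 0)" if o: "odd (card {n\<in>C - {c, c'}. ?P l n})" for l
      proof -
        have card: "card {n\<in>C. ?P l n} = card {n\<in>C - {c, c'}. ?P l n} + of_bool (?P l c) + of_bool (?P l c')"
          by (rule card_remove_pair) (use psubset.hyps c(1) c' in auto)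
        have "{n\<in>C - {c, c'}. ?P l n} \<noteq> {}" using o by (metis card.empty even_zero)
        then have lk: "2 * l + 1 < fst (cell c)" using le by force
        have "odd (card {n\<in>C. ?P l n})" using o card c'(3) by simp
        then obtain n where "n \<in> C" "cell n = (2 * l + 1, 0)" using par by blast
        then show ?thesis using lk c'(3) by (intro bexI[of _ n]) auto
      qed
      then show ?thesis
        using reduce[of c c', OF c(1) c'(1) balanced] c' cc by (simp add: matching_cells_def)
    next
      case single: False
      show ?thesis
      proof (cases "k = 0")
        case True
        have "C = {c}"
        proof -
          have "n = c" if "n \<in> C" for n
          proof -
            have "fst (cell n) = 1" using le[OF that] odd(2)[OF that] k True by (cases "fst (cell n)") auto
            then have "cell n = cell c" using odd(2)[OF that] cc True by (cases "cell n") auto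
            then show ?thesis using single that by blast
          qed
          then show ?thesis using c by blast
        qed
        then show ?thesis
          by (intro exI[of _ "\<lambda>n. n"]) (simp add: cell_pairing_def solitary_cell_def cc True)
      next
        case False
        then obtain j where j: "k = Suc j" by (cases k) auto
        have top: "{n\<in>C. ?P j n} = {c}"
        proof -
          have "n = c" if n: "n \<in> C" "?P j n" for n
          proof -
            have "fst (cell n) = 2 * k + 1" using n le[OF n(1)] k j by (auto elim!: oddE)
            then have "cell n = cell c" using n cc by (cases "cell n") auto
            then show ?thesis using single n by blast
          qed
          moreover have "?P j c" using cc j by simp
          ultimately show ?thesis using c(1) by blast
        qed
        have "odd (card {n\<in>C. ?P j n})" unfolding top by simp
        then obtain c' where c': "c' \<in> C" "cell c' = (2 * j + 1, 0)" using par by blast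
        have ne: "c \<noteq> c'" using c' cc j by auto
        have "\<exists>n\<in>C - {c, c'}. cell n = (2 * l + 1, 0)" if o: "odd (card {n\<in>C - {c, c'}. ?P l n})" for l
        proof -
          have card: "card {n\<in>C. ?P l n} = card {n\<in>C - {c, c'}. ?P l n} + of_bool (?P l c) + of_bool (?P l c')"
            by (rule card_remove_pair) (use psubset.hyps c(1) c' ne in auto)
          have "{n\<in>C - {c, c'}. ?P l n} \<noteq> {}" using o by (metis card.empty even_zero)
          then obtain n where n: "n \<in> C" "n \<noteq> c" "?P l n" by blast
          then have "\<not> ?P j n" using top by blast
          then have lj: "l < j" using n(3) by auto
          then have "odd (card {n\<in>C. ?P l n})" using o card c'(2) cc j by simp
          then obtain n where "n \<in> C" "cell n = (2 * l + 1, 0)" using par by blast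
          then show ?thesis using lj c'(2) cc j by (intro bexI[of _ n]) auto
        qed
        then show ?thesis
          using reduce[of c c', OF c(1) c'(1) balanced] c' cc ne j by (simp add: matching_cells_def)
      qed
    qed
  qed
qed

context finite_dimensional_vector_space
begin

section \<open>A parity obstruction\<close>

lemma independent_span_disjoint:
  assumes B: "independent B" and A: "A \<subseteq> B" and x: "x \<in> span A" "x \<in> span (B - A)"
  shows "x = 0"
proof -
  have "representation B x = representation A x"
    by (rule representation_extend[OF B x(1) A])
  moreover have "representation B x = representation (B - A) x"
    by (rule representation_extend[OF B x(2)]) auto
  ultimately have "representation B x v = 0" for v
    using representation_ne_zero[of A x v] representation_ne_zero[of "B - A" x v] by force
  then show ?thesis
    using sum_nonzero_representation_eq[OF B, of x] x(1) span_mono[OF A] by auto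
qed

end

context selfadjoint_endomorphism
begin

text \<open>
  The representing vector is written down in the dual basis of an orthonormal Jordan basis.
\<close>

lemma ex_representing_vector:
  assumes "\<And>x y. \<phi> (x + y) = \<phi> x + \<phi> y" "\<And>c x. \<phi> (c *s x) = c * \<phi> x"
  shows "\<exists>y. \<forall>x. b x y = \<phi> x"
proof -
  obtain cs E where cells: "orthonormal_cells cs E" and jb: "jordan_basis u cs E"
    using ex_orthonormal_jordan_basis by blast
  let ?J = "jordan_index cs"
  let ?E' = "\<lambda>(n, i). E (n, Suc (fst (cs ! n)) - i)"
  have basis: "indexed_basis ?J E" using jb by (simp add: jordan_basis_def)
  then have fin: "finite ?J" by (simp add: indexed_basis_def)
  define y where "y = (\<Sum>q\<in>?J. \<phi> (E q) *s ?E' q)"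
  have "b x y = \<phi> x" for x
  proof (induction x rule: indexed_basis_induct[OF basis])
    case 1
    then show ?case using assms(2)[of 0 0] by (simp add: form_0)
  next
    case (4 p)
    have "b (E p) y = (\<Sum>q\<in>?J. if p = q then \<phi> (E q) else 0)"
      unfolding y_def form_rules
      by (intro sum.cong) (use orthonormal_cells_dual[OF cells 4] in auto)
    then show ?case using 4 fin by simp
  qed (auto simp: assms form_rules)
  then show ?thesis by blast
qed

text \<open>
  For \<open>x\<close> outside \<open>S\<close>, a linear functional that vanishes on \<open>S\<close> but not at \<open>x\<close> is represented by a
  vector \<open>y\<close>, which contradicts the hypothesis.
\<close>

lemma in_subspace_if_orthogonal:
  assumes S: "subspace S" and x: "\<And>y. (\<And>s. s \<in> S \<Longrightarrow> b s y = 0) \<Longrightarrow> b x y = 0"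
  shows "x \<in> S"
proof (rule ccontr)
  assume "x \<notin> S"
  interpret pair: vector_space_pair scale "(*) :: 'a \<Rightarrow> 'a \<Rightarrow> 'a"
    by unfold_locales (auto simp: algebra_simps)
  obtain B where B: "B \<subseteq> S" "independent B" "S \<subseteq> span B"
    using maximal_independent_subset by blast
  have "x \<notin> span B" using \<open>x \<notin> S\<close> span_minimal[OF B(1) S] by blast
  then have ind: "independent (insert x B)" by (rule independent_insertI[OF _ B(2)])
  obtain \<phi> where \<phi>: "Vector_Spaces.linear scale (*) \<phi>" "\<forall>z\<in>insert x B. \<phi> z = (if z = x then 1 else 0)"
    using pair.linear_independent_extend[OF ind, of "\<lambda>z. if z = x then 1 else 0"] by blast
  then have lin: "\<phi> (x + y) = \<phi> x + \<phi> y" "\<phi> (c *s x) = c * \<phi> x" for x y c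
    by (auto simp: Vector_Spaces.linear_iff)
  obtain y where y: "b z y = \<phi> z" for z
    using ex_representing_vector[of \<phi>] lin by blast
  have "\<phi> s = 0" if "s \<in> span B" for s
    using that
  proof (induction rule: span_induct_alt)
    case base
    show ?case using lin(2)[of 0 0] by simp
  next
    case (step c z w)
    have "z \<noteq> x" using step B(1) \<open>x \<notin> S\<close> by blast
    then show ?case using step \<phi>(2) by (simp add: lin)
  qed
  then have "b x y = 0" using x[of y] y B(3) by auto
  then show False using y \<phi>(2) by simp
qed

text \<open>
  The map \<open>x \<mapsto> (\<Sum>y\<in>Y. b x (p y) *s y)\<close> is injective on the span of \<open>X\<close> and takes values in the
  span of \<open>Y\<close>.
\<close>

lemma card_le_if_separating:
  assumes X: "independent X" and Y: "independent Y" and p: "endo p"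
    and sep: "\<And>x. x \<in> span X \<Longrightarrow> (\<And>y. y \<in> Y \<Longrightarrow> b x (p y) = 0) \<Longrightarrow> x = 0"
  shows "card X \<le> card Y"
proof -
  interpret pair: finite_dimensional_vector_space_pair_1 scale Basis scale by unfold_locales
  have fin: "finite Y" by (rule finiteI_independent[OF Y])
  define f where "f x = (\<Sum>y\<in>Y. b x (p y) *s y)" for x
  have f: "endo f"
    by (rule endoI) (simp_all add: f_def form_rules scale_left_distrib sum.distrib scale_sum_right)
  have "x = 0" if "x \<in> span X" "f x = 0" for x
    using sep[OF that(1)] independentD[OF Y fin order_refl that(2)[unfolded f_def]] by blast
  then have "inj_on f (span X)"
    by (intro inj_onI) (metis endo_diff[OF f] right_minus_eq span_diff)
  then have "dim (f ` X) = card X"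
    using pair.dim_image_eq[OF f] dim_eq_card_independent[OF X] by simp
  moreover have "f ` X \<subseteq> span Y"
    unfolding f_def by (intro image_subsetI span_sum span_scale span_base)
  then have "dim (f ` X) \<le> card Y" using dim_le_card fin by blast
  ultimately show ?thesis by simp
qed

text \<open>
  The form \<open>b x (p y)\<close> is symmetric with radical \<open>R\<close>, the kernel of \<open>p\<close>, and the hypothesis says that
  \<open>Q\<close> is its own orthogonal complement. Then \<open>R\<close> lies in \<open>Q\<close>, and the form induces a pairing of \<open>Q / R\<close>
  with \<open>V / Q\<close> that is nondegenerate on both sides, so these quotients have the same dimension. In
  the proof they are represented by the spans of \<open>BQ - BR\<close> and \<open>BV - BQ\<close>.
\<close>

lemma dim_self_orthogonal:
  assumes p: "endo p" "\<And>x y. b (p x) y = b x (p y)"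
    and Q: "\<And>x. x \<in> Q \<longleftrightarrow> (\<forall>q\<in>Q. b x (p q) = 0)"
  shows "dim UNIV + dim {x. p x = 0} = 2 * dim Q"
proof -
  let ?R = "{x. p x = 0}"
  have Qs: "subspace Q"
  proof (rule subspaceI)
    show "0 \<in> Q" unfolding Q[of 0] by (simp add: form_0)
    show "x + y \<in> Q" if "x \<in> Q" "y \<in> Q" for x y
      unfolding Q[of "x + y"] using that Q[of x] Q[of y] by (simp add: form_rules)
    show "c *s x \<in> Q" if "x \<in> Q" for c x
      unfolding Q[of "c *s x"] using that Q[of x] by (simp add: form_rules)
  qed
  have RQ: "?R \<subseteq> Q" using Q p(2) by (metis (mono_tags) form_0(1) mem_Collect_eq subsetI)
  have Rs: "subspace ?R" by (simp add: subspace_def endo_simps[OF p(1)])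
  obtain BR where BR: "BR \<subseteq> ?R" "independent BR" "?R \<subseteq> span BR"
    using maximal_independent_subset by blast
  obtain BQ where BQ: "BR \<subseteq> BQ" "BQ \<subseteq> Q" "independent BQ" "Q \<subseteq> span BQ"
    using maximal_independent_subset_extend[of BR Q] BR RQ by blast
  obtain BV where BV: "BQ \<subseteq> BV" "BV \<subseteq> UNIV" "independent BV" "UNIV \<subseteq> span BV"
    by (rule maximal_independent_subset_extend[OF subset_UNIV BQ(3)])
  have fin: "finite BV" by (rule finiteI_independent[OF BV(3)])
  have spR: "span BR \<subseteq> ?R" by (rule span_minimal[OF BR(1) Rs])
  have spQ: "span BQ \<subseteq> Q" by (rule span_minimal[OF BQ(2) Qs])
  have ext: "b x (p y) = 0" if "\<And>y. y \<in> B \<Longrightarrow> b x (p y) = 0" "y \<in> span B" for x y B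
    using that(2) by (induction rule: span_induct_alt) (auto simp: endo_simps[OF p(1)] form_rules that(1))
  have "card (BQ - BR) \<le> card (BV - BQ)"
  proof (rule card_le_if_separating[OF _ _ p(1)])
    fix x assume x: "x \<in> span (BQ - BR)" "\<And>y. y \<in> BV - BQ \<Longrightarrow> b x (p y) = 0"
    have "x \<in> Q" using x(1) spQ span_mono[of "BQ - BR" BQ] by blast
    then have "b x (p y) = 0" if "y \<in> BV" for y
      using x(2) that BQ(2) Q by blast
    then have "b (p x) y = 0" for y using ext[of BV x y] BV(4) p(2) by auto
    then have "p x = 0" by (rule form_nondegenerate)
    then have "x \<in> span BR" using BR(3) by blast
    then show "x = 0" using independent_span_disjoint[OF BQ(3,1)] x(1) by blast
  qed (rule independent_mono[OF BQ(3) Diff_subset] independent_mono[OF BV(3) Diff_subset])+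
  moreover have "card (BV - BQ) \<le> card (BQ - BR)"
  proof (rule card_le_if_separating[OF _ _ p(1)])
    fix x assume x: "x \<in> span (BV - BQ)" "\<And>y. y \<in> BQ - BR \<Longrightarrow> b x (p y) = 0"
    have "b x (p y) = 0" if "y \<in> BQ" for y
      using x(2)[of y] that BR(1) by (cases "y \<in> BR") (auto simp: form_0)
    then have "\<forall>q\<in>Q. b x (p q) = 0" using ext[of BQ x] BQ(4) by blast
    then have "x \<in> span BQ" using Q[of x] BQ(4) by blast
    then show "x = 0" using independent_span_disjoint[OF BV(3,1)] x(1) by blast
  qed (rule independent_mono[OF BQ(3) Diff_subset] independent_mono[OF BV(3) Diff_subset])+
  ultimately have "card (BQ - BR) = card (BV - BQ)" by simp
  moreover have "card BV = card BQ + card (BV - BQ)"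
    using card_mono[OF fin BV(1)] card_Diff_subset[of BQ BV] finite_subset[OF BV(1) fin] BV(1) by simp
  moreover have "card BQ = card BR + card (BQ - BR)"
    using card_mono[of BQ BR] card_Diff_subset[of BR BQ] finite_subset[OF BV(1) fin]
      finite_subset[OF BQ(1)] BQ(1) by simp
  moreover have "dim UNIV = card BV" "dim Q = card BQ" "dim ?R = card BR"
    by (rule basis_card_eq_dim[OF subset_UNIV BV(4,3), symmetric]
      basis_card_eq_dim[OF BQ(2,4,3), symmetric] basis_card_eq_dim[OF BR(1,3,2), symmetric])+
  ultimately show ?thesis by simp
qed

text \<open>
  Let \<open>Z\<close> consist of the \<open>z\<close> with \<open>a (p z) = c (p z) = 0\<close>. The sum \<open>Q\<close> of \<open>im a\<close> and \<open>Z\<close> is totally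
  isotropic for the form \<open>b x (p y)\<close>. Conversely, let \<open>x\<close> be orthogonal to \<open>Q\<close>. Orthogonality to
  \<open>im a\<close> means \<open>a (p x) = 0\<close>, and orthogonality to \<open>Z\<close>, the common kernel of \<open>a p\<close> and \<open>c p\<close>, means
  that \<open>p x = a (p v) + c (p w)\<close> for some \<open>v\<close> and \<open>w\<close>. Then \<open>z = x - a v\<close> satisfies
  \<open>p z = c (p w)\<close>, which is killed by both \<open>a\<close> and \<open>c\<close>, so \<open>x = a v + z\<close> lies in \<open>Q\<close>. Hence \<open>Q\<close> is its
  own orthogonal complement.
\<close>

theorem even_dim_plus_dim_kernel:
  assumes a: "endo a" "\<And>x y. b (a x) y = b x (a y)" "\<And>x. a (a x) = 0"
    and c: "endo c" "\<And>x y. b (c x) y = b x (c y)" "\<And>x. c (c x) = 0"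
    and p: "endo p" "\<And>x y. b (p x) y = b x (p y)" "\<And>x. p (a x) = a (p x)" "\<And>x. p (c x) = c (p x)"
    and iso: "\<And>z z'. a (p z) = 0 \<Longrightarrow> c (p z) = 0 \<Longrightarrow> a (p z') = 0 \<Longrightarrow> c (p z') = 0 \<Longrightarrow> b z (p z') = 0"
  shows "even (dim UNIV + dim {x. p x = 0})"
proof -
  define Z where "Z = {z. a (p z) = 0 \<and> c (p z) = 0}"
  define Q where "Q = {a v + z | v z. z \<in> Z}"
  have "x \<in> Q \<longleftrightarrow> (\<forall>q\<in>Q. b x (p q) = 0)" for x
  proof
    assume "x \<in> Q"
    then obtain v z where x: "x = a v + z" "z \<in> Z" by (auto simp: Q_def)
    have "b x (p q) = 0" if qQ: "q \<in> Q" for q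
    proof -
      obtain v' z' where q: "q = a v' + z'" "z' \<in> Z" using qQ by (auto simp: Q_def)
      have "b (a v) (p (a v')) = 0" by (simp add: p(3) a form_0)
      moreover have "b (a v) (p z') = 0" using q(2) by (simp add: a(2) Z_def form_0)
      moreover have "b z (p (a v')) = 0"
      proof -
        have "b z (p (a v')) = b (a (p z)) v'" by (simp only: a(2) p(2))
        then show ?thesis using x(2) by (simp add: Z_def form_0)
      qed
      moreover have "b z (p z') = 0" using x(2) q(2) iso by (simp add: Z_def)
      ultimately show ?thesis
        by (simp add: x q endo_simps[OF p(1)] form_rules)
    qed
    then show "\<forall>q\<in>Q. b x (p q) = 0" by blast
  next
    assume perp: "\<forall>q\<in>Q. b x (p q) = 0"
    have ZQ: "z \<in> Q" if "z \<in> Z" for z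
      unfolding Q_def by (intro CollectI exI[of _ 0] exI[of _ z]) (simp add: that endo_0[OF a(1)])
    have aQ: "a v \<in> Q" for v
      unfolding Q_def Z_def
      by (intro CollectI exI[of _ v] exI[of _ 0])
        (simp add: endo_0[OF p(1)] endo_0[OF a(1)] endo_0[OF c(1)])
    define S where "S = {a (p v) + c (p w) | v w. True}"
    have SI: "a (p v) + c (p w) \<in> S" for v w by (auto simp: S_def)
    have "subspace S"
    proof (rule subspaceI)
      show "0 \<in> S" unfolding S_def
        by (intro CollectI exI[of _ 0])
          (simp add: endo_0[OF p(1)] endo_0[OF a(1)] endo_0[OF c(1)])
    next
      fix s s' assume "s \<in> S" "s' \<in> S"
      then obtain v w v' w' where "s = a (p v) + c (p w)" "s' = a (p v') + c (p w')" by (auto simp: S_def)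
      then have "s + s' = a (p (v + v')) + c (p (w + w'))"
        by (simp add: endo_simps[OF p(1)] endo_simps[OF a(1)] endo_simps[OF c(1)] algebra_simps)
      then show "s + s' \<in> S" by (auto simp: S_def)
    next
      fix k s assume "s \<in> S"
      then obtain v w where "s = a (p v) + c (p w)" by (auto simp: S_def)
      then have "k *s s = a (p (k *s v)) + c (p (k *s w))"
        by (simp add: endo_simps[OF p(1)] endo_simps[OF a(1)] endo_simps[OF c(1)] algebra_simps)
      then show "k *s s \<in> S" by (auto simp: S_def)
    qed
    moreover have "b (p x) y = 0" if y: "\<And>s. s \<in> S \<Longrightarrow> b s y = 0" for y
    proof -
      have "b (a (p v)) y = 0" for v
        using y[OF SI[of v 0]] by (simp add: endo_0[OF p(1)] endo_0[OF c(1)])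
      then have "b (p (a y)) v = 0" for v
        using form_commute by (metis a(2) p(2))
      then have "p (a y) = 0" by (rule form_nondegenerate)
      have "b (c (p v)) y = 0" for v
        using y[OF SI[of 0 v]] by (simp add: endo_0[OF p(1)] endo_0[OF a(1)])
      then have "b (p (c y)) v = 0" for v
        using form_commute by (metis c(2) p(2))
      then have "p (c y) = 0" by (rule form_nondegenerate)
      with \<open>p (a y) = 0\<close> have "y \<in> Z" by (simp add: Z_def p(3,4))
      then show ?thesis using perp ZQ by (simp add: p(2))
    qed
    ultimately have "p x \<in> S" by (rule in_subspace_if_orthogonal)
    then obtain v w where px: "p x = a (p v) + c (p w)" by (auto simp: S_def)
    have "b (a (p x)) v = 0" for v
      using bspec[OF perp aQ[of v]] by (simp add: a(2) p(2) p(3))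
    then have apx: "a (p x) = 0" by (rule form_nondegenerate)
    define z where "z = x - a v"
    have pz: "p z = c (p w)"
      by (simp add: z_def px endo_simps[OF p(1)] p(3))
    have "a (p z) = 0" using apx by (simp add: z_def endo_simps[OF p(1)] endo_simps[OF a(1)] p(3) a(3))
    moreover have "c (p z) = 0" by (simp add: pz c(3))
    ultimately have "z \<in> Z" by (simp add: Z_def)
    then show "x \<in> Q" unfolding Q_def by (intro CollectI exI[of _ v] exI[of _ z]) (simp add: z_def)
  qed
  from dim_self_orthogonal[OF p(1,2) this] show ?thesis by simp
qed

end

section \<open>Necessity of the conditions\<close>

text \<open>
  The bound \<open>M\<close> turns the sum over the sizes that occur into one over a fixed interval, which allows
  induction on the list.
\<close>

lemma sum_odd_counts:
  fixes cs :: "(nat \<times> 'a) list"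
  assumes "\<And>p. p \<in> set cs \<Longrightarrow> fst p \<le> 2 * M"
  shows "(\<Sum>i | i > k \<and> count_list cs (2 * i + 1, c) \<noteq> 0. count_list cs (2 * i + 1, c))
    = length (filter (\<lambda>(m, a). a = c \<and> odd m \<and> 2 * k + 1 < m) cs)"
proof -
  have "(\<Sum>i | i > k \<and> count_list cs (2 * i + 1, c) \<noteq> 0. count_list cs (2 * i + 1, c))
      = (\<Sum>i\<in>{k<..M}. count_list cs (2 * i + 1, c))"
  proof (rule sum.mono_neutral_left)
    show "{i. i > k \<and> count_list cs (2 * i + 1, c) \<noteq> 0} \<subseteq> {k<..M}"
    proof
      fix i assume i: "i \<in> {i. i > k \<and> count_list cs (2 * i + 1, c) \<noteq> 0}"
      then have "(2 * i + 1, c) \<in> set cs" by (metis (mono_tags, lifting) count_list_0_iff mem_Collect_eq)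
      from assms[OF this] i show "i \<in> {k<..M}" by simp
    qed
  qed auto
  also have "\<dots> = length (filter (\<lambda>(m, a). a = c \<and> odd m \<and> 2 * k + 1 < m) cs)"
    using assms
  proof (induction cs)
    case (Cons p cs)
    obtain m a where p: "p = (m, a)" by (cases p)
    have m: "m \<le> 2 * M" using Cons.prems[of p] by (simp add: p)
    have new: "(\<Sum>i\<in>{k<..M}. of_bool (p = (2 * i + 1, c)))
        = of_bool (a = c \<and> odd m \<and> 2 * k + 1 < m)"
    proof (cases "a = c \<and> odd m")
      case True
      then obtain j where j: "m = 2 * j + 1" by (auto elim: oddE)
      have "(\<Sum>i\<in>{k<..M}. of_bool (p = (2 * i + 1, c))) = (\<Sum>i\<in>{k<..M}. if i = j then 1 else 0)"
        by (rule sum.cong) (auto simp: p j True)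
      then show ?thesis using m True by (auto simp: j)
    next
      case False
      then have "p \<noteq> (2 * i + 1, c)" for i by (auto simp: p)
      then show ?thesis using False by auto
    qed
    have step: "count_list (p # cs) x = count_list cs x + of_bool (p = x)" for x by simp
    have "(\<Sum>i\<in>{k<..M}. count_list cs (2 * i + 1, c))
        = length (filter (\<lambda>(m, a). a = c \<and> odd m \<and> 2 * k + 1 < m) cs)"
      using Cons by simp
    then show ?case unfolding step sum.distrib new by (simp add: p)
  qed simp
  finally show ?thesis .
qed

text \<open>
  A cell of size \<open>m\<close> for \<open>c\<close> contributes \<open>m\<close> to the first and \<open>min (2 k) m\<close> to the second kernel
  dimension. The sum of the two is odd exactly if \<open>m\<close> is odd and larger than \<open>2 k\<close>.
\<close>

lemma even_kernel_dim_difference: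
  assumes "\<And>p. p \<in> set cs \<Longrightarrow> fst p \<le> 2 * M"
  shows "even (kernel_dim cs c (2 * M) + kernel_dim cs c (2 * k) +
    length (filter (\<lambda>(m, a). a = c \<and> odd m \<and> 2 * k < m) cs))"
  using assms
proof (induction cs)
  case (Cons p cs)
  obtain m a where p: "p = (m, a)" by (cases p)
  have m: "m \<le> 2 * M" using Cons.prems[of p] by (simp add: p)
  have IH: "even (kernel_dim cs c (2 * M) + kernel_dim cs c (2 * k) +
      length (filter (\<lambda>(m, a). a = c \<and> odd m \<and> 2 * k < m) cs))"
    using Cons by simp
  show ?case
  proof (cases "a = c")
    case True
    have "kernel_dim (p # cs) c (2 * M) = m + kernel_dim cs c (2 * M)"
      "kernel_dim (p # cs) c (2 * k) = min (2 * k) m + kernel_dim cs c (2 * k)"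
      using m by (simp_all add: kernel_dim_def p True)
    then show ?thesis using IH by (cases "m \<le> 2 * k") (auto simp: p True)
  next
    case False
    then show ?thesis using IH by (simp add: kernel_dim_def p)
  qed
qed (simp add: kernel_dim_def)

lemma count_list_card: "count_list xs x = card {n\<in>{..<length xs}. xs ! n = x}"
proof -
  have "count_list xs x = length (filter ((=) x) xs)"
    by (rule count_list_eq_length_filter)
  also have "\<dots> = card {n. n < length xs \<and> x = xs ! n}" by (rule length_filter_conv_card)
  also have "{n. n < length xs \<and> x = xs ! n} = {n\<in>{..<length xs}. xs ! n = x}" by auto
  finally show ?thesis .
qed

context selfadjoint_endomorphism
begin

text \<open>
  Modulo the kernel of \<open>u^k\<close>, the kernel of \<open>u^(k + 1)\<close> is spanned by the vectors \<open>E (n, k + 1)\<close> of the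
  cells for \<open>0\<close> of size at least \<open>k + 1\<close>. If no cell has exactly this size, all of them are images
  under \<open>u\<close>.
\<close>

lemma kernel_power_Int_range:
  assumes jb: "jordan_basis u cs E" and 0: "count_list cs (Suc k, 0) = 0"
    and x: "(u ^^ Suc k) x = 0"
  shows "\<exists>y. (u ^^ k) x = (u ^^ k) (u y)"
proof -
  let ?J = "jordan_index cs"
  have E0: "E (n, 0) = 0"
    and rel: "(n, i) \<in> ?J \<Longrightarrow> u (E (n, i)) = snd (cs ! n) *s E (n, i) + E (n, i - 1)" for n i
    using jb by (auto simp: jordan_basis_def)
  note ker = generalised_kernel_eq_span[OF endo_u jb, where c = 0, simplified]
  note p_simps = endo_simps[OF endo_funpow[OF endo_u]]
  have "x \<in> span (E ` {(n, i)\<in>?J. snd (cs ! n) = 0 \<and> i \<le> Suc k})"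
    using x ker[of "Suc k"] by (auto simp del: funpow.simps)
  then show ?thesis
  proof (induction rule: span_induct_alt)
    case base
    show ?case by (rule exI[of _ 0]) (simp add: u_simps)
  next
    case (step c w y)
    obtain n i where w: "w = E (n, i)" "(n, i) \<in> ?J" "snd (cs ! n) = 0" "i \<le> Suc k"
      using step(1) by auto
    have "\<exists>v. (u ^^ k) w = (u ^^ k) (u v)"
    proof (cases "i = Suc k")
      case True
      have "cs ! n \<noteq> (Suc k, 0)"
        using 0 w(2) by (auto simp: count_list_0_iff jordan_index_def dest!: nth_mem)
      then have "fst (cs ! n) \<noteq> Suc k" using w(3) by (cases "cs ! n") auto
      then have "(n, Suc i) \<in> ?J" using w True by (auto simp: jordan_index_def)
      then have "u (E (n, Suc i)) = w" using rel w by simp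
      then show ?thesis by metis
    next
      case False
      then have "w \<in> span (E ` {(n, i)\<in>?J. snd (cs ! n) = 0 \<and> i \<le> k})"
        using w by (auto intro!: span_base)
      then have "(u ^^ k) w = 0" using ker[of k] by auto
      then show ?thesis by (intro exI[of _ 0]) (simp add: u_simps p_simps)
    qed
    then obtain v where "(u ^^ k) w = (u ^^ k) (u v)" by blast
    moreover obtain z where "(u ^^ k) y = (u ^^ k) (u z)" using step.IH by blast
    ultimately show ?case
      by (intro exI[of _ "c *s v + z"]) (simp add: u_simps p_simps)
  qed
qed

text \<open>
  With \<open>d = a - c\<close>, an element of the kernel of \<open>d\<close> is killed by \<open>u u = - d d\<close>, so \<open>d\<close> is injective
  on generalised eigenspaces for nonzero eigenvalues; this gives the first part. For the second part,
  \<open>even_dim_plus_dim_kernel\<close> is applied with \<open>p = u^(2 k)\<close>. It commutes with \<open>a\<close> and \<open>c\<close> since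
  \<open>u u = a c + c a\<close> does. An element \<open>p z\<close> that is killed by \<open>a\<close> and \<open>c\<close> lies in the kernel of \<open>u\<close>,
  hence equals \<open>p (u y)\<close> for some \<open>y\<close> when there is no cell of size \<open>2 k + 1\<close>, and so is orthogonal to
  every \<open>z'\<close> with \<open>u (p z') = 0\<close>. The same holds for a large exponent \<open>2 M\<close>; subtraction removes
  the dimension of the whole space.
\<close>

theorem square_zero_sum_imp_conditions:
  assumes a: "selfadjoint_endo scale b a" "\<And>x. a (a x) = 0"
    and c: "selfadjoint_endo scale b c" "\<And>x. c (c x) = 0"
    and sum: "\<And>x. u x = a x + c x" and jb: "jordan_basis u cs E"
  shows "\<forall>k\<ge>1. \<forall>ev. ev \<noteq> 0 \<longrightarrow> count_list cs (k, ev) = count_list cs (k, - ev)"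
    and "count_list cs (2 * k + 1, 0) = 0 \<Longrightarrow>
      even (length (filter (\<lambda>(m, ev). ev = 0 \<and> odd m \<and> 2 * k + 1 < m) cs))"
proof -
  have ea: "endo a" and ec: "endo c" and ba: "b (a x) y = b x (a y)" and bc: "b (c x) y = b x (c y)" for x y
    using a(1) c(1) by (auto simp: selfadjoint_endo_def)
  note a_simps = endo_simps[OF ea] and c_simps = endo_simps[OF ec]
  define d where "d x = a x - c x" for x
  have d: "endo d" by (rule endoI) (auto simp: d_def a_simps c_simps algebra_simps)
  have anti: "d (u x) = - u (d x)" for x
    by (simp add: d_def sum a_simps c_simps a(2) c(2))
  have dd: "d (d x) = - u (u x)" for x
    by (simp add: d_def sum a_simps c_simps a(2) c(2))
  have inj: "x = 0" if ev: "ev \<noteq> 0" and x: "(shifted ev ^^ k) x = 0" "d x = 0" for ev k x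
  proof -
    have "u (u x) = 0" using dd[of x] x(2) by (simp add: endo_0[OF d])
    have pow: "(shifted ev ^^ j) y = (- ev) ^ j *s y" if "u y = 0" for j y
      by (induction j) (simp_all add: that u_simps scale_minus_left)
    have "(shifted ev ^^ k) (u x) = u ((shifted ev ^^ k) x)"
      by (induction k) (simp_all add: u_simps)
    then have "(- ev) ^ k *s u x = 0"
      using pow[OF \<open>u (u x) = 0\<close>, of k] x(1) by (simp add: u_simps)
    then have "u x = 0" using ev by simp
    then have "(- ev) ^ k *s x = 0" using pow[of x k] x(1) by simp
    then show "x = 0" using ev by simp
  qed
  have le: "kernel_dim cs ev k \<le> kernel_dim cs (- ev) k" if "ev \<noteq> 0" for ev k
    using dim_kernel_anticommuting[OF endo_u d anti, where c = ev and k = k] inj[OF that]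
    by (simp only: dim_generalised_kernel[OF endo_u jb])
  have "count_list cs (Suc k, ev) = count_list cs (Suc k, - ev)" if "ev \<noteq> 0" for k ev
    by (rule count_list_eq_if_kernel_dim_eq)
      (use le[of ev] le[of "- ev"] that in \<open>auto intro: antisym\<close>)
  then show "\<forall>k\<ge>1. \<forall>ev. ev \<noteq> 0 \<longrightarrow> count_list cs (k, ev) = count_list cs (k, - ev)"
    by (metis Suc_pred' less_eq_Suc_le One_nat_def)
  have even: "even (dim UNIV + kernel_dim cs 0 (2 * k))" if 0: "count_list cs (2 * k + 1, 0) = 0" for k
  proof -
    let ?p = "u ^^ (2 * k)"
    have p: "endo ?p" by (rule endo_funpow[OF endo_u])
    have bp: "b (?p x) y = b x (?p y)" for x y by (rule form_funpow) (rule form_u)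
    have pa: "?p (a x) = a (?p x)" and pc: "?p (c x) = c (?p x)" for x
      by (induction k) (simp_all add: sum a_simps c_simps a(2) c(2))
    have "b z (?p z') = 0"
      if "a (?p z) = 0" "c (?p z) = 0" "a (?p z') = 0" "c (?p z') = 0" for z z'
    proof -
      have "(u ^^ Suc (2 * k)) z' = 0" using that sum[of "?p z'"] by simp
      then obtain y where "?p z' = ?p (u y)"
        using kernel_power_Int_range[OF jb, of "2 * k" z'] 0 by auto
      then have "b z (?p z') = b (u (?p z)) y" by (simp add: form_u flip: bp)
      also have "u (?p z) = 0" using that sum[of "?p z"] by simp
      finally show ?thesis by (simp add: form_0)
    qed
    then have "even (dim UNIV + dim {x. ?p x = 0})"
      using even_dim_plus_dim_kernel[OF ea ba a(2) ec bc c(2) p bp pa pc] by blast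
    then show ?thesis using dim_generalised_kernel[OF endo_u jb, where c = 0 and k = "2 * k"] by simp
  qed
  define M where "M = sum_list (map fst cs)"
  have M: "fst p \<le> 2 * M" if "p \<in> set cs" for p
    using member_le_sum_list[of "fst p" "map fst cs"] that by (simp add: M_def)
  have "count_list cs (2 * M + 1, 0) = 0" using M by (fastforce simp: count_list_0_iff)
  then have evM: "even (dim UNIV + kernel_dim cs 0 (2 * M))" by (rule even)
  assume 0: "count_list cs (2 * k + 1, 0) = 0"
  have "filter (\<lambda>(m, ev). ev = 0 \<and> odd m \<and> 2 * k + 1 < m) cs
      = filter (\<lambda>(m, ev). ev = 0 \<and> odd m \<and> 2 * k < m) cs"
  proof (rule filter_cong)
    fix p assume "p \<in> set cs"
    then have "p \<noteq> (2 * k + 1, 0)" using 0 by (auto simp: count_list_0_iff)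
    then show "(case p of (m, ev) \<Rightarrow> ev = 0 \<and> odd m \<and> 2 * k + 1 < m) =
        (case p of (m, ev) \<Rightarrow> ev = 0 \<and> odd m \<and> 2 * k < m)"
      by (cases p) (auto simp: Suc_lessI)
  qed simp
  then show "even (length (filter (\<lambda>(m, ev). ev = 0 \<and> odd m \<and> 2 * k + 1 < m) cs))"
    using even_kernel_dim_difference[where cs = cs and M = M and c = 0 and k = k] M even[OF 0] evM by simp
qed

end

section \<open>Construction of an anticommuting partner\<close>

locale paired_jordan_basis = selfadjoint_endomorphism scale Basis b u
  for scale :: "'a::alg_closed_field \<Rightarrow> 'v::ab_group_add \<Rightarrow> 'v" (infixr "*s" 75)
    and Basis :: "'v set" and b :: "'v \<Rightarrow> 'v \<Rightarrow> 'a" and u :: "'v \<Rightarrow> 'v" +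
  fixes cs :: "(nat \<times> 'a) list" and E :: "nat \<times> nat \<Rightarrow> 'v" and t :: "nat \<Rightarrow> nat" and \<iota> :: 'a
  assumes cells: "orthonormal_cells cs E" and jb: "jordan_basis u cs E"
    and pairing: "cell_pairing {..<length cs} ((!) cs) t"
    and iota: "\<iota> * \<iota> = - 1"
begin

abbreviation "J \<equiv> jordan_index cs"

definition cell_size :: "nat \<Rightarrow> nat" where "cell_size n = fst (cs ! n)"

definition eigenvalue :: "nat \<Rightarrow> 'a" where "eigenvalue n = snd (cs ! n)"

lemma J_iff: "(n, i) \<in> J \<longleftrightarrow> n < length cs \<and> 1 \<le> i \<and> i \<le> cell_size n"
  by (auto simp: jordan_index_def cell_size_def)

lemma basis: "indexed_basis J E" and E_0: "E (n, 0) = 0"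
  using jb by (auto simp: jordan_basis_def)

lemma u_E: "n < length cs \<Longrightarrow> i \<le> cell_size n \<Longrightarrow> u (E (n, i)) = eigenvalue n *s E (n, i) + E (n, i - 1)"
  using jb by (cases "i = 0") (auto simp: jordan_basis_def J_iff eigenvalue_def E_0 u_simps)

lemma b_E:
  assumes "n < length cs" "i \<le> cell_size n" "m < length cs" "k \<le> cell_size m" "1 \<le> i \<or> 1 \<le> k"
  shows "b (E (n, i)) (E (m, k)) = of_bool (n = m \<and> i + k = Suc (cell_size n))"
proof (cases "i = 0 \<or> k = 0")
  case True
  then show ?thesis using assms by (auto simp: E_0 form_0)
next
  case False
  then have "(n, i) \<in> J" "(m, k) \<in> J" using assms by (auto simp: J_iff)
  then show ?thesis using cells by (simp add: orthonormal_cells_def cell_size_def)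
qed

lemma pairing_rules:
  assumes "n < length cs"
  shows "t n < length cs" "t (t n) = n" "t n = n \<Longrightarrow> eigenvalue n = 0 \<and> (even (cell_size n) \<or> cell_size n = 1)"
    and "eigenvalue (t n) = - eigenvalue n"
    and "cell_size n = cell_size (t n) \<or> eigenvalue n = 0 \<and> odd (cell_size n) \<and> (cell_size n = cell_size (t n) + 2 \<or> cell_size (t n) = cell_size n + 2)"
proof -
  have "t n \<in> {..<length cs}" "t (t n) = n"
    "if t n = n then solitary_cell (cs ! n) else matching_cells (cs ! n) (cs ! t n)"
    using pairing assms unfolding cell_pairing_def by blast+
  then show "t n < length cs" "t (t n) = n" "t n = n \<Longrightarrow> eigenvalue n = 0 \<and> (even (cell_size n) \<or> cell_size n = 1)"
    "eigenvalue (t n) = - eigenvalue n"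
    "cell_size n = cell_size (t n) \<or> eigenvalue n = 0 \<and> odd (cell_size n) \<and> (cell_size n = cell_size (t n) + 2 \<or> cell_size (t n) = cell_size n + 2)"
    by (cases "t n = n"; simp add: solitary_cell_def matching_cells_def cell_size_def eigenvalue_def)+
qed

lemma pairing_cases:
  assumes "n < length cs"
  obtains (same) "cell_size (t n) = cell_size n"
    | (shorter) "cell_size n = cell_size (t n) + 2" "cell_size (t n) \<noteq> cell_size n" "cell_size (t n) \<noteq> cell_size n + 2" "odd (cell_size n)" "eigenvalue n = 0" "eigenvalue (t n) = 0"
    | (longer) "cell_size (t n) = cell_size n + 2" "cell_size (t n) \<noteq> cell_size n" "cell_size n \<noteq> cell_size (t n) + 2" "odd (cell_size n)" "eigenvalue n = 0" "eigenvalue (t n) = 0"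
proof -
  consider "cell_size n = cell_size (t n)" | "eigenvalue n = 0" "odd (cell_size n)" "cell_size n = cell_size (t n) + 2"
    | "eigenvalue n = 0" "odd (cell_size n)" "cell_size (t n) = cell_size n + 2"
    using pairing_rules(5)[OF assms] by blast
  then show thesis
  proof cases
    case 1
    then show ?thesis using same by simp
  next
    case 2
    then show ?thesis using shorter pairing_rules(4)[OF assms] by simp
  next
    case 3
    then show ?thesis using longer pairing_rules(4)[OF assms] by simp
  qed
qed

text \<open>
  For two different odd cells of equal size the selfadjointness of \<open>d\<close> forces the scalars of the two
  cells to be negatives of each other, while \<open>d d = - u u\<close> forces their product to be \<open>1\<close>. This is why
  one cell of the pair gets \<open>\<iota>\<close> and the other one \<open>- \<iota>\<close>.
\<close>

definition pair_scalar :: "nat \<Rightarrow> 'a"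
  where "pair_scalar n = (if even (cell_size n) \<or> t n = n then 1 else if n < t n then \<iota> else - \<iota>)"

lemma pair_scalar_mult:
  assumes "n < length cs" "cell_size (t n) = cell_size n"
  shows "pair_scalar n * pair_scalar (t n) = 1"
proof (cases "t n = n")
  case True
  then show ?thesis by (simp add: pair_scalar_def)
next
  case False
  have "pair_scalar (t n) = (if even (cell_size n) then 1 else if t n < n then \<iota> else - \<iota>)"
    unfolding pair_scalar_def pairing_rules(2)[OF assms(1)] assms(2) using False by simp
  then show ?thesis using False iota by (auto simp: pair_scalar_def)
qed

text \<open>
  The sign \<open>(-1)^i\<close> makes \<open>d\<close> anticommute with \<open>u\<close>. Between cells of sizes \<open>m + 2\<close> and \<open>m\<close> with
  eigenvalue \<open>0\<close>, going to the smaller cell lowers the place by two and going to the larger one keeps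
  it. Both ways together lower the place by two, as \<open>u u\<close> does. For \<open>i = 1\<close> the truncated difference
  \<open>i - 2\<close> is \<open>0\<close>, which fits because \<open>E (n, 0) = 0\<close>.
\<close>

definition partner_on_basis :: "nat \<Rightarrow> nat \<Rightarrow> 'v"
  where "partner_on_basis n i = (if cell_size (t n) = cell_size n then (pair_scalar n * (- 1) ^ i) *s u (E (t n, i))
    else (\<iota> * (- 1) ^ i) *s E (t n, if cell_size n = cell_size (t n) + 2 then i - 2 else i))"

definition d :: "'v \<Rightarrow> 'v"
  where "d = (SOME f. endo f \<and> (\<forall>n i. (n, i) \<in> J \<longrightarrow> f (E (n, i)) = partner_on_basis n i))"

lemma endo_d: "endo d" and d_basis: "(n, i) \<in> J \<Longrightarrow> d (E (n, i)) = partner_on_basis n i"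
proof -
  have "\<exists>f. endo f \<and> (\<forall>n i. (n, i) \<in> J \<longrightarrow> f (E (n, i)) = partner_on_basis n i)"
    using indexed_basis_extend[OF basis, of "\<lambda>(n, i). partner_on_basis n i"] by fast
  then have "endo d \<and> (\<forall>n i. (n, i) \<in> J \<longrightarrow> d (E (n, i)) = partner_on_basis n i)"
    unfolding d_def by (rule someI_ex)
  then show "endo d" "(n, i) \<in> J \<Longrightarrow> d (E (n, i)) = partner_on_basis n i" by blast+
qed

lemmas d_simps = endo_simps[OF endo_d]

lemma d_E: "n < length cs \<Longrightarrow> i \<le> cell_size n \<Longrightarrow> d (E (n, i)) = partner_on_basis n i"
  using d_basis by (cases "i = 0") (auto simp: J_iff partner_on_basis_def E_0 d_simps u_simps)

lemma d_u: "d (u x) = - u (d x)"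
proof (rule indexed_basis_eqI[OF basis, of "\<lambda>x. d (u x)" "\<lambda>x. - u (d x)"])
  fix p assume "p \<in> J"
  then obtain n i where p: "p = (n, i)" and n: "n < length cs" "1 \<le> i" "i \<le> cell_size n"
    by (cases p) (auto simp: J_iff)
  obtain j where j: "i = Suc j" using n by (cases i) auto
  note tn = pairing_rules[OF n(1)]
  have du: "d (u (E p)) = eigenvalue n *s partner_on_basis n i + partner_on_basis n j"
    using n d_E[of n i] d_E[of n j] u_E[of n i] by (simp add: p j d_simps)
  have ud: "u (d (E p)) = u (partner_on_basis n i)" using d_E[OF n(1,3)] by (simp add: p)
  have shift: "u (E (t n, k)) = - eigenvalue n *s E (t n, k) + E (t n, k - 1)" if "k \<le> cell_size (t n)" for k
    using u_E[OF tn(1) that] by (simp add: tn(4))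
  show "d (u (E p)) = - u (d (E p))"
    using n(1)
  proof (cases rule: pairing_cases)
    case same
    have "u (E (t n, i)) = - eigenvalue n *s E (t n, i) + E (t n, j)"
      using shift[of i] same n by (simp add: j)
    then have uu: "u (u (E (t n, Suc j))) = - eigenvalue n *s u (E (t n, Suc j)) + u (E (t n, j))"
      by (simp only: u_simps j)
    show ?thesis
      unfolding du ud
      by (simp add: partner_on_basis_def same u_simps j uu scale_right_distrib scale_right_diff_distrib mult_ac)
  next
    case shorter
    then show ?thesis
      unfolding du ud using shift[of "i - 2"] n by (simp add: partner_on_basis_def u_simps j numeral_2_eq_2)
  next
    case longer
    then show ?thesis
      unfolding du ud using shift[of i] n by (simp add: partner_on_basis_def u_simps j)
  qed
qed (auto intro!: endoI simp: d_simps u_simps)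

lemma d_d: "d (d x) = - u (u x)"
proof (rule indexed_basis_eqI[OF basis, of "\<lambda>x. d (d x)" "\<lambda>x. - u (u x)"])
  fix p assume "p \<in> J"
  then obtain n i where p: "p = (n, i)" and n: "n < length cs" "1 \<le> i" "i \<le> cell_size n"
    by (cases p) (auto simp: J_iff)
  note tn = pairing_rules[OF n(1)]
  have dE: "d (E p) = partner_on_basis n i" using d_E[OF n(1,3)] by (simp add: p)
  have uuE: "u (u (E p)) = E (n, i - 2)" if "eigenvalue n = 0"
  proof -
    have "u (E p) = E (n, i - 1)" using u_E[OF n(1,3)] that by (simp add: p)
    moreover have "u (E (n, i - 1)) = E (n, i - 1 - 1)" using u_E[of n "i - 1"] that n by simp
    ultimately show ?thesis by (simp add: numeral_2_eq_2)
  qed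
  show "d (d (E p)) = - u (u (E p))"
    using n(1)
  proof (cases rule: pairing_cases)
    case same
    have "partner_on_basis (t n) i = (pair_scalar (t n) * (- 1) ^ i) *s u (E (n, i))"
      unfolding partner_on_basis_def tn(2) by (simp add: same)
    moreover have "d (E (t n, i)) = partner_on_basis (t n) i" using d_E[of "t n" i] tn(1) n same by simp
    ultimately have "u (d (E (t n, i))) = (pair_scalar (t n) * (- 1) ^ i) *s u (u (E p))"
      by (simp add: u_simps p)
    moreover have "d (d (E p)) = - ((pair_scalar n * (- 1) ^ i) *s u (d (E (t n, i))))"
      unfolding dE partner_on_basis_def by (simp add: same d_simps d_u)
    ultimately have "d (d (E p)) = - (((pair_scalar n * pair_scalar (t n)) * ((- 1) ^ i * (- 1) ^ i)) *s u (u (E p)))"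
      by (simp add: mult_ac)
    then show ?thesis by (simp add: pair_scalar_mult[OF n(1) same])
  next
    case shorter
    have "d (E (t n, i - 2)) = (\<iota> * (- 1) ^ (i - 2)) *s E (n, i - 2)"
      using d_E[OF tn(1), of "i - 2"] n shorter by (simp add: partner_on_basis_def tn(2))
    then have "d (d (E p)) = (\<iota> * (- 1) ^ i * (\<iota> * (- 1) ^ (i - 2))) *s E (n, i - 2)"
      unfolding dE by (simp add: partner_on_basis_def shorter d_simps)
    moreover have "(\<iota> * (- 1) ^ i * (\<iota> * (- 1) ^ (i - 2))) *s E (n, i - 2) = - E (n, i - 2)"
    proof (cases "2 \<le> i")
      case True
      then obtain j where "i = 2 + j" using le_Suc_ex by blast
      then have "(- 1 :: 'a) ^ i = (- 1) ^ (i - 2)" by simp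
      then have "\<iota> * (- 1) ^ i * (\<iota> * (- 1) ^ (i - 2)) = (\<iota> * \<iota>) * ((- 1) ^ i * (- 1) ^ i)"
        by (simp add: mult_ac)
      then show ?thesis by (simp add: iota)
    next
      case False
      then show ?thesis by (simp add: E_0)
    qed
    ultimately show ?thesis using uuE shorter by simp
  next
    case longer
    have "d (E (t n, i)) = (\<iota> * (- 1) ^ i) *s E (n, i - 2)"
      using d_E[OF tn(1), of i] n longer by (simp add: partner_on_basis_def tn(2))
    then have "d (d (E p)) = ((\<iota> * \<iota>) * ((- 1) ^ i * (- 1) ^ i)) *s E (n, i - 2)"
      unfolding dE by (simp add: partner_on_basis_def longer d_simps mult_ac)
    then show ?thesis using uuE longer by (simp add: iota)
  qed
qed (auto intro!: endoI simp: d_simps u_simps)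

lemma form_partner_other_cell:
  assumes n: "n < length cs" "i \<le> cell_size n" and m: "m < length cs" "1 \<le> k" "k \<le> cell_size m" "m \<noteq> t n"
  shows "b (partner_on_basis n i) (E (m, k)) = 0"
proof -
  note tn = pairing_rules[OF n(1)]
  have 0: "b (E (t n, j)) (E (m, k)) = 0" if "j \<le> cell_size (t n)" for j
    using b_E[OF tn(1) that m(1,3)] m by auto
  show ?thesis
    using n(1)
  proof (cases rule: pairing_cases)
    case same
    then show ?thesis
      using 0[of i] 0[of "i - 1"] n u_E[OF tn(1), of i] by (simp add: partner_on_basis_def form_rules)
  next
    case shorter
    then show ?thesis using 0[of "i - 2"] n by (simp add: partner_on_basis_def form_rules)
  next
    case longer
    then show ?thesis using 0[of i] n by (simp add: partner_on_basis_def form_rules)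
  qed
qed

lemma pair_scalar_sign:
  assumes "n < length cs" "cell_size (t n) = cell_size n"
  shows "pair_scalar (t n) = (if even (cell_size n) then pair_scalar n else - pair_scalar n) \<or> (t n = n \<and> eigenvalue n = 0 \<and> cell_size n = 1)"
proof (cases "t n = n")
  case True
  then show ?thesis using pairing_rules(3)[OF assms(1)] by auto
next
  case False
  have "pair_scalar (t n) = (if even (cell_size n) then 1 else if t n < n then \<iota> else - \<iota>)"
    unfolding pair_scalar_def pairing_rules(2)[OF assms(1)] assms(2) using False by simp
  then show ?thesis using False by (auto simp: pair_scalar_def)
qed

text \<open>
  Both sides can be nonzero only if \<open>i + k\<close> has one particular value, or one of two consecutive values
  for cells of equal size. This value fixes the parity of \<open>i + k\<close> and thus the relation between the
  signs \<open>(-1)^i\<close> and \<open>(-1)^k\<close>, which \<open>pair_scalar\<close> compensates.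
\<close>

lemma form_partner_paired_cell:
  assumes n: "n < length cs" "1 \<le> i" "i \<le> cell_size n" and k: "1 \<le> k" "k \<le> cell_size (t n)"
  shows "b (partner_on_basis n i) (E (t n, k)) = b (partner_on_basis (t n) k) (E (n, i))"
proof -
  note tn = pairing_rules[OF n(1)]
  show ?thesis
    using n(1)
  proof (cases rule: pairing_cases)
    case same
    obtain i' where i': "i = Suc i'" using n(2) by (cases i) auto
    obtain k' where k': "k = Suc k'" using k(1) by (cases k) auto
    have kn: "k \<le> cell_size n" using k same by simp
    have uE: "u (E (t n, i)) = - eigenvalue n *s E (t n, i) + E (t n, i')"
      using u_E[OF tn(1), of i] n same by (simp add: tn(4) i')
    have uE': "u (E (n, k)) = eigenvalue n *s E (n, k) + E (n, k')"
      using u_E[OF n(1) kn] by (simp add: k')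
    have "b (E (t n, j)) (E (t n, k)) = of_bool (j + k = Suc (cell_size n))" if "j \<le> cell_size n" for j
      using b_E[OF tn(1) _ tn(1) k(2), of j] that k same by simp
    then have l: "b (partner_on_basis n i) (E (t n, k)) = pair_scalar n * (- 1) ^ i *
        (- eigenvalue n * of_bool (i + k = Suc (cell_size n)) + of_bool (i + k' = Suc (cell_size n)))"
      using n(3) by (simp add: partner_on_basis_def same uE[unfolded i'] form_rules i' k')
    have "b (E (n, j)) (E (n, i)) = of_bool (i + j = Suc (cell_size n))" if "j \<le> cell_size n" for j
      using b_E[OF n(1) that n(1,3)] n(2) by (simp add: add.commute)
    then have r: "b (partner_on_basis (t n) k) (E (n, i)) = pair_scalar (t n) * (- 1) ^ k *
        (eigenvalue n * of_bool (i + k = Suc (cell_size n)) + of_bool (i + k' = Suc (cell_size n)))"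
      unfolding partner_on_basis_def tn(2) using kn by (simp add: same uE'[unfolded k'] form_rules k')
    consider (a) "i + k = Suc (cell_size n)" "i + k' \<noteq> Suc (cell_size n)" | (b) "i + k' = Suc (cell_size n)" "i + k \<noteq> Suc (cell_size n)"
      | (c) "i + k \<noteq> Suc (cell_size n)" "i + k' \<noteq> Suc (cell_size n)" using k' by linarith
    then show ?thesis
    proof cases
      case a
      have "even (i + k) = odd (cell_size n)" using a(1) by simp
      then have sgn: "(- 1 :: 'a) ^ k = (if even (cell_size n) then - ((- 1) ^ i) else (- 1) ^ i)"
        by (cases "even i"; cases "even k"; simp)
      show ?thesis
        unfolding l r using a pair_scalar_sign[OF n(1) same] by (auto simp: sgn)
    next
      case b
      have "even (i + k) = even (cell_size n)" using b(1) k' by simp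
      then have sgn: "(- 1 :: 'a) ^ k = (if even (cell_size n) then (- 1) ^ i else - ((- 1) ^ i))"
        by (cases "even i"; cases "even k"; simp)
      have "cell_size n \<noteq> 1" using b n kn k' by linarith
      then show ?thesis
        unfolding l r using b pair_scalar_sign[OF n(1) same] by (auto simp: sgn)
    next
      case c
      then show ?thesis unfolding l r by simp
    qed
  next
    case shorter
    have "b (partner_on_basis n i) (E (t n, k)) = \<iota> * (- 1) ^ i * of_bool (i + k = Suc (cell_size n))"
      using b_E[OF tn(1) _ tn(1) k(2), of "i - 2"] n k shorter
      by (auto simp: partner_on_basis_def form_rules)
    moreover have "b (partner_on_basis (t n) k) (E (n, i)) = \<iota> * (- 1) ^ k * of_bool (i + k = Suc (cell_size n))"
      using b_E[OF n(1) _ n(1,3), of k] n k shorter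
      by (simp add: partner_on_basis_def tn(2) form_rules add.commute)
    moreover have "(- 1 :: 'a) ^ i = (- 1) ^ k" if "i + k = Suc (cell_size n)"
    proof -
      have "even (i + k)" using that shorter by simp
      then show ?thesis by (simp add: minus_one_power_iff)
    qed
    ultimately show ?thesis by auto
  next
    case longer
    have "b (partner_on_basis n i) (E (t n, k)) = \<iota> * (- 1) ^ i * of_bool (i + k = Suc (cell_size (t n)))"
      using b_E[OF tn(1) _ tn(1) k(2), of i] n k longer by (simp add: partner_on_basis_def form_rules)
    moreover have "b (partner_on_basis (t n) k) (E (n, i)) = \<iota> * (- 1) ^ k * of_bool (i + k = Suc (cell_size (t n)))"
      using b_E[OF n(1) _ n(1,3), of "k - 2"] n k longer
      by (auto simp: partner_on_basis_def tn(2) form_rules)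
    moreover have "(- 1 :: 'a) ^ i = (- 1) ^ k" if "i + k = Suc (cell_size (t n))"
    proof -
      have "even (i + k)" using that longer by simp
      then show ?thesis by (simp add: minus_one_power_iff)
    qed
    ultimately show ?thesis by auto
  qed
qed

lemma form_d: "b (d x) y = b x (d y)"
proof (induction x rule: indexed_basis_induct[OF basis])
  case (4 p)
  show ?case
  proof (induction y rule: indexed_basis_induct[OF basis])
    case (4 q)
    obtain n i m k where pq: "p = (n, i)" "q = (m, k)" by (cases p, cases q)
    have n: "n < length cs" "1 \<le> i" "i \<le> cell_size n" and m: "m < length cs" "1 \<le> k" "k \<le> cell_size m"
      using \<open>p \<in> J\<close> \<open>q \<in> J\<close> by (auto simp: pq J_iff)
    have "b (partner_on_basis n i) (E (m, k)) = b (partner_on_basis m k) (E (n, i))"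
    proof (cases "m = t n")
      case True
      then show ?thesis using form_partner_paired_cell[OF n] m by simp
    next
      case False
      then have "n \<noteq> t m" using pairing_rules(2)[OF m(1)] by auto
      then show ?thesis
        using form_partner_other_cell[OF n(1,3) m False] form_partner_other_cell[OF m(1,3) n] by simp
    qed
    then show ?case
      using d_E[OF n(1,3)] d_E[OF m(1,3)] by (simp add: pq form_commute[of "E (n, i)"])
  qed (auto simp: d_simps form_rules)
qed (auto simp: d_simps form_rules)

end

context selfadjoint_endomorphism
begin

text \<open>
  The summands are \<open>(u + d) / 2\<close> and \<open>(u - d) / 2\<close>.
\<close>

theorem ex_square_zero_sum:
  assumes cells: "orthonormal_cells cs E" and jb: "jordan_basis u cs E"
    and neg: "\<forall>k\<ge>1. \<forall>ev. ev \<noteq> 0 \<longrightarrow> count_list cs (k, ev) = count_list cs (k, - ev)"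
    and odd: "\<And>k. odd (length (filter (\<lambda>(m, ev). ev = 0 \<and> odd m \<and> 2 * k + 1 < m) cs)) \<Longrightarrow>
      count_list cs (2 * k + 1, 0) > 0"
  shows "\<exists>a c. selfadjoint_endo scale b a \<and> selfadjoint_endo scale b c \<and>
    (\<forall>x. a (a x) = 0) \<and> (\<forall>x. c (c x) = 0) \<and> (\<forall>x. u x = a x + c x)"
proof -
  have "balanced_cells {..<length cs} ((!) cs)"
    unfolding balanced_cells_def
  proof (intro conjI allI impI)
    fix m and ev :: 'a assume "ev \<noteq> 0"
    have "count_list cs (m, ev) = count_list cs (m, - ev)"
    proof (cases "m = 0")
      case True
      have "count_list cs (0, e) = 0" for e
        using jb by (force simp: jordan_basis_def count_list_0_iff)
      then show ?thesis by (simp add: True)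
    next
      case False
      then show ?thesis using \<open>ev \<noteq> 0\<close> by (intro neg[rule_format]) auto
    qed
    then show "card {n\<in>{..<length cs}. cs ! n = (m, ev)} = card {n\<in>{..<length cs}. cs ! n = (m, - ev)}"
      by (simp only: count_list_card)
  next
    fix k
    assume "odd (card {n\<in>{..<length cs}. snd (cs ! n) = 0 \<and> odd (fst (cs ! n)) \<and> 2 * k + 1 < fst (cs ! n)})"
    also have "card {n\<in>{..<length cs}. snd (cs ! n) = 0 \<and> odd (fst (cs ! n)) \<and> 2 * k + 1 < fst (cs ! n)}
        = length (filter (\<lambda>(m, ev). ev = 0 \<and> odd m \<and> 2 * k + 1 < m) cs)"
      unfolding length_filter_conv_card by (rule arg_cong[of _ _ card]) (auto simp: case_prod_unfold)
    finally have "count_list cs (2 * k + 1, 0) > 0" by (rule odd)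
    then have "(2 * k + 1, 0) \<in> set cs" by (metis count_list_0_iff less_numeral_extra(3))
    then show "\<exists>n\<in>{..<length cs}. cs ! n = (2 * k + 1, 0)" by (auto simp: in_set_conv_nth)
  qed
  then obtain t where t: "cell_pairing {..<length cs} ((!) cs) t"
    using ex_cell_pairing[OF two_nonzero] by blast
  obtain \<iota> :: 'a where iota: "\<iota> * \<iota> = - 1"
    using nth_root_exists[of 2 "- 1 :: 'a"] by (auto simp: power2_eq_square)
  interpret paired_jordan_basis scale Basis b u cs E t \<iota>
    by unfold_locales (fact cells jb t iota)+
  define h where "h = (1 / 2 :: 'a)"
  have half: "h *s x + h *s x = x" for x
    using two_nonzero by (simp add: h_def flip: scale_left_distrib)
  define a where "a x = h *s (u x + d x)" for x
  define c where "c x = h *s (u x - d x)" for x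
  note simps = d_simps u_simps
  have "endo a" "endo c"
    by (rule endoI; simp add: a_def c_def simps algebra_simps)+
  then have "selfadjoint_endo scale b a" "selfadjoint_endo scale b c"
    by (simp_all add: selfadjoint_endo_def a_def c_def form_rules form_u form_d)
  moreover have "a (a x) = 0" for x
    unfolding a_def by (simp add: simps d_u d_d scale_right_distrib scale_right_diff_distrib)
  moreover have "c (c x) = 0" for x
    unfolding c_def by (simp add: simps d_u d_d scale_right_distrib scale_right_diff_distrib)
  moreover have "u x = a x + c x" for x
    using half[of "u x"] by (simp add: a_def c_def algebra_simps)
  ultimately show ?thesis by blast
qed

end

section \<open>The characterisation\<close>

theorem theorem1p17:
  fixes scale :: "'a::alg_closed_field \<Rightarrow> 'v::ab_group_add \<Rightarrow> 'v"
    and Basis :: "'v set"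
    and b :: "'v \<Rightarrow> 'v \<Rightarrow> 'a"
    and u :: "'v \<Rightarrow> 'v"
  assumes "CHAR('a) \<noteq> 2"
    and "finite_dimensional_vector_space scale Basis"
    and "bilinear_form scale b" "symmetric_form b" "nondegenerate_form b"
    and "selfadjoint_endo scale b u"
  shows
    "((\<exists>a1 a2. selfadjoint_endo scale b a1 \<and> selfadjoint_endo scale b a2 \<and>
          (\<forall>x. a1 (a1 x) = 0) \<and> (\<forall>x. a2 (a2 x) = 0) \<and> (\<forall>x. u x = a1 x + a2 x))
      \<longleftrightarrow>
      (similar_endo scale u (\<lambda>x. - u x) \<and>
       (\<forall>k::nat. odd (\<Sum>i | i > k \<and> jordan_cells scale u 0 (2 * i + 1) \<noteq> 0.
                        jordan_cells scale u 0 (2 * i + 1))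
                 \<longrightarrow> jordan_cells scale u 0 (2 * k + 1) > 0)))
     \<and>
     (similar_endo scale u (\<lambda>x. - u x) \<longleftrightarrow>
       (\<forall>k\<ge>1. \<forall>ev. ev \<noteq> 0 \<longrightarrow> jordan_cells scale u ev k = jordan_cells scale u (- ev) k))"
proof -
  have two: "(2::'a) \<noteq> 0"
  proof
    assume "(2::'a) = 0"
    then have "of_nat 2 = (0::'a)" by simp
    then have "CHAR('a) dvd 2" by (simp only: of_nat_eq_0_iff_char_dvd)
    then have "CHAR('a) = 1 \<or> CHAR('a) = 2" using two_is_prime_nat by (auto simp: prime_nat_iff)
    then show False using assms(1) by simp
  qed
  interpret finite_dimensional_vector_space scale Basis by fact
  interpret selfadjoint_endomorphism scale Basis b u
    by unfold_locales (use two assms in auto)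
  obtain cs E where cells: "orthonormal_cells cs E" and jb: "jordan_basis u cs E"
    using ex_orthonormal_jordan_basis by blast
  have jc: "jordan_cells scale u ev k = count_list cs (k, ev)" if "k \<ge> 1" for ev k
    by (rule jordan_cells_eq_count_list[OF endo_u jb that])
  have similar: "similar_endo scale u (\<lambda>x. - u x) \<longleftrightarrow>
      (\<forall>k\<ge>1. \<forall>ev. ev \<noteq> 0 \<longrightarrow> count_list cs (k, ev) = count_list cs (k, - ev))"
    by (rule similar_neg_iff_count_list[OF endo_u jb])
  have M: "fst p \<le> 2 * sum_list (map fst cs)" if "p \<in> set cs" for p
    using member_le_sum_list[of "fst p" "map fst cs"] that by simp
  have sum: "(\<Sum>i | i > k \<and> jordan_cells scale u 0 (2 * i + 1) \<noteq> 0. jordan_cells scale u 0 (2 * i + 1))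
      = length (filter (\<lambda>(m, ev). ev = 0 \<and> odd m \<and> 2 * k + 1 < m) cs)" for k
    using sum_odd_counts[where cs = cs and M = "sum_list (map fst cs)" and k = k and c = 0] M jc by simp
  have "(\<exists>a1 a2. selfadjoint_endo scale b a1 \<and> selfadjoint_endo scale b a2 \<and>
          (\<forall>x. a1 (a1 x) = 0) \<and> (\<forall>x. a2 (a2 x) = 0) \<and> (\<forall>x. u x = a1 x + a2 x))
      \<longleftrightarrow> ((\<forall>k\<ge>1. \<forall>ev. ev \<noteq> 0 \<longrightarrow> count_list cs (k, ev) = count_list cs (k, - ev)) \<and>
        (\<forall>k. odd (length (filter (\<lambda>(m, ev). ev = 0 \<and> odd m \<and> 2 * k + 1 < m) cs)) \<longrightarrow>
          count_list cs (2 * k + 1, 0) > 0))" (is "?L \<longleftrightarrow> ?R")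
  proof
    assume ?L
    then obtain a c where "selfadjoint_endo scale b a" "selfadjoint_endo scale b c"
      "\<And>x. a (a x) = 0" "\<And>x. c (c x) = 0" "\<And>x. u x = a x + c x" by blast
    from square_zero_sum_imp_conditions[OF this(1,3,2,4,5) jb]
    show ?R by blast
  next
    assume ?R
    then show ?L using ex_square_zero_sum[OF cells jb] by blast
  qed
  then show ?thesis
    unfolding similar sum using jc by simp
qed

end
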